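(* In the setting described in the context (problem $\min F=f+r$, stochastic models satisfying (A1)–(A5), $\lambda\in(0,(\tau+\rho)^{-1})$, nonincreasing step-sizes $\{\eta_t\}_{t\ge 0}\subseteq(0,\lambda)$, iteration count $T$), assume $F$ attains its minimum. Then the random point $x_{t^*}$ returned by the stochastic model-based minimization algorithm satisfies $$\mathbb{E}\left[D_{\Phi}\left(\mathrm{prox}_{\lambda F}^\Phi (x_{t^*}),x_{t^*}\right)\right]\le \frac{\lambda^2}{1 - \lambda (\tau + \rho)} \left( \frac{F_\lambda^\Phi(x_0) - \min F}{\sum_{t=0}^{T} \frac{\eta_t}{1-\eta_t \rho}} + \frac{ \mathsf{L}^2\sum_{t=0}^{T} \frac{ \eta_t^2 }{4\lambda(1 -\eta_t \rho)} }{\sum_{t=0}^{T} \frac{\eta_t}{1-\eta_t \rho}} + \frac{\frac{\eta_0}{\lambda(1-\eta_0\rho)} (r(x_0)-\inf r) }{\sum_{t=0}^{T} \frac{\eta_t}{1-\eta_t \rho}} \right).$$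
   Context: Legendre functions. $\Phi\colon\mathbb{R}^d\to\mathbb{R}\cup\{\infty\}$ is a Legendre function: it is proper, closed, strictly convex; $U:=\mathrm{int}(\mathrm{dom}\,\Phi)$ is nonempty; $\Phi$ is differentiable on $U$; and $\|\nabla\Phi(x_k)\|\to\infty$ for any sequence $\{x_k\}\subset U$ converging to a boundary point of $\mathrm{dom}\,\Phi$. Its Bregman divergence is $D_\Phi(y,x)=\Phi(y)-\Phi(x)-\langle\nabla\Phi(x),y-x\rangle$ for $x\in U$, $y\in\mathrm{dom}\,\Phi$. A function $g$ is $\rho$-weakly convex relative to $\Phi$ if $g+\rho\Phi$ is convex (for a function defined only on $U$: convex on $U$). Problem. $\min_x F(x):=f(x)+r(x)$, where $f\colon\mathbb{R}^d\to\mathbb{R}$ is locally Lipschitz, $r\colon\mathbb{R}^d\to\mathbb{R}\cup\{\infty\}$ is closed with convex domain, and $\mathrm{ri}(\mathrm{dom}\,r)\subseteq U$ and $\partial(r+\Phi)(x)=\emptyset$ for all $x\notin U$. Here $\partial$ is the limiting subdifferential: $v\in\partial g(x)$ iff there are $x_k\to x$ with $g(x_k)\to g(x)$ and $v_k\to v$ with $v_k\in\hat\partial g(x_k)$, where $\hat\partial g(x)=\{v: g(y)\ge g(x)+\langle v,y-x\rangle+o(\|y-x\|)\text{ as }y\to x\}$. Assumptions. $(\Omega,\mathcal{F},P)$ is a probability space and there are $\tau,\rho,\mathsf{L}>0$ such that: (A1) i.i.d. samples $\xi_0,\xi_1,\ldots\sim P$ can be generated. (A2) There is a measurable function $(x,y,\xi)\mapsto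 f_x(y,\xi)$ on $U\times U\times\Omega$ with $\mathbb{E}_\xi[f_x(x,\xi)]=f(x)$ for all $x\in U\cap\mathrm{dom}\,r$ and $\mathbb{E}_\xi[f_x(y,\xi)-f(y)]\le\tau D_\Phi(y,x)$ for all $x,y\in U\cap\mathrm{dom}\,r$. (A3) $f_x(\cdot,\xi)+r(\cdot)$ is $\rho$-weakly convex relative to $\Phi$ for all $x\in U\cap\mathrm{dom}\,r$ and a.e. $\xi\in\Omega$. (A4) There is a square integrable $L\colon\Omega\to\mathbb{R}_+$ with $\sqrt{\mathbb{E}_\xi[L(\xi)^2]}\le\mathsf{L}$ and $f_x(x,\xi)-f_x(y,\xi)\le L(\xi)\sqrt{D_\Phi(y,x)}$ for all $x,y\in U\cap\mathrm{dom}\,r$. (A5) For every $0<\lambda<(\tau+\rho)^{-1}$, $x\in U$ and a.e. $\xi$, the problems $\min_y\{F(y)+\frac1\lambda D_\Phi(y,x)\}$ and $\min_y\{f_x(y,\xi)+r(y)+\frac1\lambda D_\Phi(y,x)\}$ admit minimizers (which are unique and lie in $U$), varying measurably in $(x,\xi)\in U\times\Omega$. Minimization involving the models is over $y\in U$. Envelope and proximal map. $F_\lambda^\Phi(x):=\inf_y\{F(y)+\frac1\lambda D_\Phi(y,x)\}$ and $\mathrm{prox}_{\lambda F}^\Phi(x):=\mathrm{argmin}_y\{F(y)+\frac1\lambda D_\Phi(y,x)\}$. Algorithm (stochastic model-based minimization). Input: $x_0\in U\cap\mathrm{dom}\,r$, $0<\lambda<(\tau+\rho)^{-1}$, a nonincreasing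 sequence $\{\eta_t\}_{t\ge0}\subseteq(0,\lambda)$, iteration count $T$. For $t=0,\ldots,T$: sample $\xi_t\sim P$ (independently) and set $x_{t+1}=\mathrm{argmin}_x\{f_{x_t}(x,\xi_t)+r(x)+\frac{1}{\eta_t}D_\Phi(x,x_t)\}$. Then sample $t^*\in\{0,\ldots,T\}$, independently of the $\xi_t$, with $\mathbb{P}(t^*=t)\propto\frac{\eta_t}{1-\eta_t\rho}$ and return $x_{t^*}$. The expectation is over all randomness. *)

theory Defs
  imports "HOL-Probability.Probability" "HOL-Library.Landau_Symbols"
begin

text \<open>
  Functions with values in the reals extended by \<open>\<infinity>\<close> are rendered as \<open>ereal\<close>-valued functions that
  avoid \<open>-\<infinity>\<close>; the latter is always stated explicitly.
\<close>

definition effdom :: "('a \<Rightarrow> ereal) \<Rightarrow> 'a set" where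
  "effdom g = {x. g x < \<infinity>}"

definition closed_fun :: "('a::topological_space \<Rightarrow> ereal) \<Rightarrow> bool" where
  "closed_fun g \<longleftrightarrow> closed {(x, t::real). g x \<le> ereal t}"

text \<open>Since \<open>0 * \<infinity> = 0\<close> in \<open>ereal\<close>, the cases \<open>u = 0\<close> and \<open>v = 0\<close> below are trivially true.\<close>

definition convex_fun_on :: "'a::real_vector set \<Rightarrow> ('a \<Rightarrow> ereal) \<Rightarrow> bool" where
  "convex_fun_on S g \<longleftrightarrow> convex S \<and>
     (\<forall>x\<in>S. \<forall>y\<in>S. \<forall>u\<ge>0. \<forall>v\<ge>0. u + v = 1 \<longrightarrow>
        g (u *\<^sub>R x + v *\<^sub>R y) \<le> ereal u * g x + ereal v * g y)"

definition strictly_convex_fun :: "('a::real_vector \<Rightarrow> ereal) \<Rightarrow> bool" where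
  "strictly_convex_fun g \<longleftrightarrow> convex (effdom g) \<and>
     (\<forall>x\<in>effdom g. \<forall>y\<in>effdom g. \<forall>u>0. \<forall>v>0. x \<noteq> y \<longrightarrow> u + v = 1 \<longrightarrow>
        g (u *\<^sub>R x + v *\<^sub>R y) < ereal u * g x + ereal v * g y)"

definition locally_lipschitz :: "('a::metric_space \<Rightarrow> 'b::metric_space) \<Rightarrow> bool" where
  "locally_lipschitz f \<longleftrightarrow> (\<forall>x. \<exists>\<epsilon>>0. \<exists>K. K-lipschitz_on (ball x \<epsilon>) f)"

definition grad :: "('a::euclidean_space \<Rightarrow> ereal) \<Rightarrow> 'a \<Rightarrow> 'a" where
  "grad g x = (THE v. GDERIV (\<lambda>y. real_of_ereal (g y)) x :> v)"


subsection \<open>Limiting subdifferential\<close>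

text \<open>As usual, both subdifferentials are empty at points outside the effective domain.\<close>

definition frechet_subdiff :: "('a::euclidean_space \<Rightarrow> ereal) \<Rightarrow> 'a \<Rightarrow> 'a set" where
  "frechet_subdiff g x = {v. \<bar>g x\<bar> \<noteq> \<infinity> \<and>
     (\<exists>e \<in> o[at x](\<lambda>y. norm (y - x)). \<forall>\<^sub>F y in at x. g y \<ge> g x + ereal (v \<bullet> (y - x)) + ereal (e y))}"

definition limiting_subdiff :: "('a::euclidean_space \<Rightarrow> ereal) \<Rightarrow> 'a \<Rightarrow> 'a set" where
  "limiting_subdiff g x = {v. \<bar>g x\<bar> \<noteq> \<infinity> \<and>
     (\<exists>X V. X \<longlonglongrightarrow> x \<and> (\<lambda>k. g (X k)) \<longlonglongrightarrow> g x \<and> V \<longlonglongrightarrow> v \<and> (\<forall>k. V k \<in> frechet_subdiff g (X k)))}"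


subsection \<open>Legendre functions and Bregman divergences\<close>

abbreviation intdom :: "('a::topological_space \<Rightarrow> ereal) \<Rightarrow> 'a set" where
  "intdom \<Phi> \<equiv> interior (effdom \<Phi>)"

definition legendre :: "('a::euclidean_space \<Rightarrow> ereal) \<Rightarrow> bool" where
  "legendre \<Phi> \<longleftrightarrow>
     (\<forall>x. \<Phi> x \<noteq> -\<infinity>) \<and> effdom \<Phi> \<noteq> {} \<and> closed_fun \<Phi> \<and> strictly_convex_fun \<Phi> \<and>
     intdom \<Phi> \<noteq> {} \<and>
     (\<forall>x\<in>intdom \<Phi>. (\<lambda>y. real_of_ereal (\<Phi> y)) differentiable (at x)) \<and>
     (\<forall>X x. (\<forall>k. X k \<in> intdom \<Phi>) \<longrightarrow> X \<longlonglongrightarrow> x \<longrightarrow> x \<in> frontier (effdom \<Phi>) \<longrightarrow>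
        filterlim (\<lambda>k. norm (grad \<Phi> (X k))) at_top sequentially)"

text \<open>Only meaningful for \<open>x \<in> intdom \<Phi>\<close>; then the value is \<open>\<infinity>\<close> for \<open>y\<close> outside \<open>effdom \<Phi>\<close>.\<close>

definition bregman :: "('a::euclidean_space \<Rightarrow> ereal) \<Rightarrow> 'a \<Rightarrow> 'a \<Rightarrow> ereal" where
  "bregman \<Phi> y x = \<Phi> y - \<Phi> x - ereal (grad \<Phi> x \<bullet> (y - x))"

definition rel_weakly_convex_on ::
    "'a::euclidean_space set \<Rightarrow> ('a \<Rightarrow> ereal) \<Rightarrow> real \<Rightarrow> ('a \<Rightarrow> ereal) \<Rightarrow> bool" where
  "rel_weakly_convex_on S \<Phi> \<rho> g \<longleftrightarrow> convex_fun_on S (\<lambda>y. g y + ereal \<rho> * \<Phi> y)"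

definition envelope ::
    "('a::euclidean_space \<Rightarrow> ereal) \<Rightarrow> ('a \<Rightarrow> ereal) \<Rightarrow> real \<Rightarrow> 'a \<Rightarrow> ereal" where
  "envelope \<Phi> F lam x = (INF y. F y + ereal (1 / lam) * bregman \<Phi> y x)"

definition prox ::
    "('a::euclidean_space \<Rightarrow> ereal) \<Rightarrow> ('a \<Rightarrow> ereal) \<Rightarrow> real \<Rightarrow> 'a \<Rightarrow> 'a" where
  "prox \<Phi> F lam x = (ARG_MIN (\<lambda>y. F y + ereal (1 / lam) * bregman \<Phi> y x) y. True)"


subsection \<open>The problem and its stochastic models\<close>

definition objective :: "('a \<Rightarrow> real) \<Rightarrow> ('a \<Rightarrow> ereal) \<Rightarrow> 'a \<Rightarrow> ereal" where
  "objective f r x = ereal (f x) + r x"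

definition composite_problem ::
    "('a::euclidean_space \<Rightarrow> ereal) \<Rightarrow> ('a \<Rightarrow> real) \<Rightarrow> ('a \<Rightarrow> ereal) \<Rightarrow> bool" where
  "composite_problem \<Phi> f r \<longleftrightarrow>
     locally_lipschitz f \<and>
     (\<forall>x. r x \<noteq> -\<infinity>) \<and> closed_fun r \<and> convex (effdom r) \<and>
     rel_interior (effdom r) \<subseteq> intdom \<Phi> \<and>
     (\<forall>x. x \<notin> intdom \<Phi> \<longrightarrow> limiting_subdiff (\<lambda>y. r y + \<Phi> y) x = {})"

text \<open>
  A model \<open>m x y \<xi>\<close> stands for the value at \<open>y\<close> of the model with base point \<open>x\<close> and sample \<open>\<xi>\<close>;
  only its values for \<open>x\<close> and \<open>y\<close> in \<open>intdom \<Phi>\<close> matter.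
\<close>

definition one_sided_accurate ::
    "'s measure \<Rightarrow> ('a::euclidean_space \<Rightarrow> ereal) \<Rightarrow> ('a \<Rightarrow> real) \<Rightarrow> ('a \<Rightarrow> ereal) \<Rightarrow>
      ('a \<Rightarrow> 'a \<Rightarrow> 's \<Rightarrow> real) \<Rightarrow> real \<Rightarrow> bool" where
  "one_sided_accurate P \<Phi> f r m \<tau> \<longleftrightarrow>
     (\<lambda>(x, y, \<xi>). m x y \<xi>) \<in> borel_measurable
        (restrict_space borel (intdom \<Phi>) \<Otimes>\<^sub>M (restrict_space borel (intdom \<Phi>) \<Otimes>\<^sub>M P)) \<and>
     (\<forall>x \<in> intdom \<Phi> \<inter> effdom r. integrable P (m x x) \<and> (\<integral>\<xi>. m x x \<xi> \<partial>P) = f x) \<and>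
     (\<forall>x \<in> intdom \<Phi> \<inter> effdom r. \<forall>y \<in> intdom \<Phi> \<inter> effdom r. integrable P (m x y) \<and>
        ereal (\<integral>\<xi>. m x y \<xi> - f y \<partial>P) \<le> ereal \<tau> * bregman \<Phi> y x)"

definition weakly_convex_models ::
    "'s measure \<Rightarrow> ('a::euclidean_space \<Rightarrow> ereal) \<Rightarrow> ('a \<Rightarrow> ereal) \<Rightarrow>
      ('a \<Rightarrow> 'a \<Rightarrow> 's \<Rightarrow> real) \<Rightarrow> real \<Rightarrow> bool" where
  "weakly_convex_models P \<Phi> r m \<rho> \<longleftrightarrow>
     (\<forall>x \<in> intdom \<Phi> \<inter> effdom r. AE \<xi> in P.
        rel_weakly_convex_on (intdom \<Phi>) \<Phi> \<rho> (\<lambda>y. ereal (m x y \<xi>) + r y))"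

definition lipschitz_models ::
    "'s measure \<Rightarrow> ('a::euclidean_space \<Rightarrow> ereal) \<Rightarrow> ('a \<Rightarrow> ereal) \<Rightarrow>
      ('a \<Rightarrow> 'a \<Rightarrow> 's \<Rightarrow> real) \<Rightarrow> real \<Rightarrow> bool" where
  "lipschitz_models P \<Phi> r m C \<longleftrightarrow>
     (\<exists>L \<in> borel_measurable P. (\<forall>\<xi>\<in>space P. 0 \<le> L \<xi>) \<and>
        integrable P (\<lambda>\<xi>. (L \<xi>)\<^sup>2) \<and> sqrt (\<integral>\<xi>. (L \<xi>)\<^sup>2 \<partial>P) \<le> C \<and>
        (\<forall>x \<in> intdom \<Phi> \<inter> effdom r. \<forall>y \<in> intdom \<Phi> \<inter> effdom r. \<forall>\<xi>\<in>space P.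
           m x x \<xi> - m x y \<xi> \<le> L \<xi> * sqrt (real_of_ereal (bregman \<Phi> y x))))"

definition unique_min_on :: "('a \<Rightarrow> ereal) \<Rightarrow> 'a set \<Rightarrow> 'a \<Rightarrow> bool" where
  "unique_min_on g S z \<longleftrightarrow>
     is_arg_min g (\<lambda>y. y \<in> S) z \<and> (\<forall>z'. is_arg_min g (\<lambda>y. y \<in> S) z' \<longrightarrow> z' = z)"

definition prox_solvable ::
    "('a::euclidean_space \<Rightarrow> ereal) \<Rightarrow> ('a \<Rightarrow> ereal) \<Rightarrow> real \<Rightarrow> bool" where
  "prox_solvable \<Phi> F \<Lambda> \<longleftrightarrow>
     (\<forall>lam. 0 < lam \<longrightarrow> lam < \<Lambda> \<longrightarrow>
        prox \<Phi> F lam \<in> restrict_space borel (intdom \<Phi>) \<rightarrow>\<^sub>M restrict_space borel (intdom \<Phi>) \<and>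
        (\<forall>x \<in> intdom \<Phi>.
           unique_min_on (\<lambda>y. F y + ereal (1 / lam) * bregman \<Phi> y x) UNIV (prox \<Phi> F lam x)))"

text \<open>
  \<open>S lam x \<xi>\<close> is a jointly measurable version of the map sending \<open>(x, \<xi>)\<close> to the minimizer of the
  proximal model subproblem with parameter \<open>lam\<close>. That subproblem is only required to have a (unique)
  minimizer for almost every \<open>\<xi>\<close>, where the exceptional set may depend on \<open>x\<close>; on it, the value of
  \<open>S\<close> is an arbitrary point of \<open>intdom \<Phi>\<close>.
\<close>

definition model_argmin_map ::
    "'s measure \<Rightarrow> ('a::euclidean_space \<Rightarrow> ereal) \<Rightarrow> ('a \<Rightarrow> ereal) \<Rightarrow>
      ('a \<Rightarrow> 'a \<Rightarrow> 's \<Rightarrow> real) \<Rightarrow> real \<Rightarrow> (real \<Rightarrow> 'a \<Rightarrow> 's \<Rightarrow> 'a) \<Rightarrow> bool" where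
  "model_argmin_map P \<Phi> r m \<Lambda> S \<longleftrightarrow>
     (\<forall>lam. 0 < lam \<longrightarrow> lam < \<Lambda> \<longrightarrow>
        (\<lambda>(x, \<xi>). S lam x \<xi>) \<in>
          restrict_space borel (intdom \<Phi>) \<Otimes>\<^sub>M P \<rightarrow>\<^sub>M restrict_space borel (intdom \<Phi>) \<and>
        (\<forall>x \<in> intdom \<Phi>. AE \<xi> in P.
           unique_min_on (\<lambda>y. ereal (m x y \<xi>) + r y + ereal (1 / lam) * bregman \<Phi> y x)
             (intdom \<Phi>) (S lam x \<xi>)))"


subsection \<open>The algorithm\<close>

primrec iterate ::
    "(real \<Rightarrow> 'a \<Rightarrow> 's \<Rightarrow> 'a) \<Rightarrow> (nat \<Rightarrow> real) \<Rightarrow> 'a \<Rightarrow> (nat \<Rightarrow> 's) \<Rightarrow> nat \<Rightarrow> 'a" where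
  "iterate S \<eta> x\<^sub>0 z 0 = x\<^sub>0"
| "iterate S \<eta> x\<^sub>0 z (Suc t) = S (\<eta> t) (iterate S \<eta> x\<^sub>0 z t) (z t)"

text \<open>The last conjunct says that \<open>t\<^sub>*\<close> is independent of the family of samples.\<close>

definition algorithm_randomness ::
    "'w measure \<Rightarrow> 's measure \<Rightarrow> real \<Rightarrow> (nat \<Rightarrow> real) \<Rightarrow> nat \<Rightarrow> (nat \<Rightarrow> 'w \<Rightarrow> 's) \<Rightarrow> ('w \<Rightarrow> nat) \<Rightarrow> bool" where
  "algorithm_randomness M P \<rho> \<eta> T \<xi> tstar \<longleftrightarrow>
     prob_space M \<and>
     prob_space.indep_vars M (\<lambda>_. P) \<xi> {..T} \<and>
     (\<forall>t\<le>T. distr M P (\<xi> t) = P) \<and>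
     tstar \<in> M \<rightarrow>\<^sub>M count_space UNIV \<and>
     (\<forall>t. measure M {\<omega> \<in> space M. tstar \<omega> = t} =
        (if t \<le> T then (\<eta> t / (1 - \<eta> t * \<rho>)) / (\<Sum>i\<le>T. \<eta> i / (1 - \<eta> i * \<rho>)) else 0)) \<and>
     prob_space.indep_set M
       (sets (vimage_algebra (space M) tstar (count_space UNIV)))
       (sets (vimage_algebra (space M) (\<lambda>\<omega>. \<lambda>t\<in>{..T}. \<xi> t \<omega>) (PiM {..T} (\<lambda>_. P))))"

end

theory Submission
  imports Defs
begin

text \<open>
  Write \<open>D\<close> for the Bregman divergence of \<open>\<Phi>\<close>, \<open>F = f + r\<close>, \<open>y\<^sub>t\<close> for the proximal point of \<open>F\<close> at the iterate
  \<open>x\<^sub>t\<close>, and \<open>w\<^sub>t = \<eta>\<^sub>t / (1 - \<eta>\<^sub>t \<rho>)\<close>. The envelope of \<open>F\<close> serves as a Lyapunov function: in expectation it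
  decreases along the iteration by a multiple of \<open>D(y\<^sub>t, x\<^sub>t)\<close>, up to a noise term and a term that
  telescopes.

  The model subproblem solved by \<open>x\<^sub>t\<^sub>+\<^sub>1\<close> is strongly convex relative to \<open>\<Phi>\<close>, so comparing its value at
  \<open>x\<^sub>t\<^sub>+\<^sub>1\<close> with that at \<open>y\<^sub>t\<close> bounds \<open>D(y\<^sub>t, x\<^sub>t\<^sub>+\<^sub>1) / w\<^sub>t\<close> (lemmas \<open>bregman_three_point\<close> and \<open>model_step_bound\<close>).
  But \<open>F y\<^sub>t + D(y\<^sub>t, x\<^sub>t\<^sub>+\<^sub>1) / lam\<close> is an upper bound for the envelope at \<open>x\<^sub>t\<^sub>+\<^sub>1\<close>. Taking the expectation over
  the sample replaces model values by values of \<open>f\<close>, with an error \<open>\<tau> D(y\<^sub>t, x\<^sub>t)\<close>, and the inequality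
  \<open>F y\<^sub>t + D(y\<^sub>t, x\<^sub>t) / lam \<le> F x\<^sub>t\<close> then gives (lemma \<open>expected_step\<close>) that the expected envelope at \<open>x\<^sub>t\<^sub>+\<^sub>1\<close> is at
  most the one at \<open>x\<^sub>t\<close> plus
    \<open>(w\<^sub>t / lam) (r x\<^sub>t - E r x\<^sub>t\<^sub>+\<^sub>1) + w\<^sub>t \<eta>\<^sub>t C\<^sup>2 / (4 lam) - ((1 - lam (\<tau> + \<rho>)) / lam\<^sup>2) w\<^sub>t D(y\<^sub>t, x\<^sub>t)\<close>.

  Summing over \<open>t\<close>, the envelopes telescope and are bounded below by the minimum of \<open>F\<close>. The differences
  of \<open>r\<close> carry the weights \<open>w\<^sub>t\<close>, which are nonincreasing, so summation by parts bounds their sum by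
  \<open>(w\<^sub>0 / lam) (r x\<^sub>0 - inf r)\<close> (lemma \<open>weighted_telescoping\<close>). Since \<open>tstar\<close> is independent of the samples and
  equals \<open>t\<close> with probability proportional to \<open>w\<^sub>t\<close>, the resulting weighted sum of the expectations of
  \<open>D(y\<^sub>t, x\<^sub>t)\<close> is, after normalization, the expectation to be bounded (lemma \<open>nn_integral_random_index\<close>).

  Everything is measured by nonnegative gaps above the infima of \<open>F\<close> and \<open>r\<close>, so that the expectations
  are integrals of nonnegative functions, and the telescoping takes place in the extended nonnegative
  reals.
\<close>

section \<open>Legendre functions and their Bregman divergences\<close>

lemma closed_fun_borel_measurable:
  fixes g :: "'a::euclidean_space \<Rightarrow> ereal"
  assumes "closed_fun g"
  shows "g \<in> borel_measurable borel"
  unfolding borel_measurable_iff_Iic_ereal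
proof (intro allI)
  fix u :: ereal
  have real: "g -` {..ereal t} \<inter> space borel \<in> sets borel" for t :: real
  proof -
    have "closed ((\<lambda>x. (x, t)) -` {(x, t::real). g x \<le> ereal t})"
      using assms unfolding closed_fun_def
      by (intro closed_vimage continuous_intros) auto
    then have "closed (g -` {..ereal t})"
      by (simp add: vimage_def)
    then show ?thesis
      by simp
  qed
  show "g -` {..u} \<inter> space borel \<in> sets borel"
  proof (cases u)
    case MInf
    (* The epigraph only records finite levels, so the level -\<infinity> is reached as a countable intersection. *)
    have "g x = -\<infinity> \<longleftrightarrow> (\<forall>n::nat. g x \<le> ereal (- real n))" for x
    proof (cases "g x")
      case (real a)
      obtain n :: nat where "- a < real n"
        using reals_Archimedean2 by blast
      then show ?thesis
        using real by (auto intro!: exI[of _ n])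
    qed auto
    then have "g -` {..u} \<inter> space borel = (\<Inter>n::nat. g -` {..ereal (- real n)} \<inter> space borel)"
      using MInf by auto
    then show ?thesis
      using real by auto
  next
    case PInf
    then have "g -` {..u} \<inter> space borel = space borel"
      by auto
    then show ?thesis
      by (simp only: sets.top)
  qed (use real in auto)
qed

lemma legendre_abs_finite:
  assumes "legendre \<Phi>" "x \<in> effdom \<Phi>"
  shows "\<bar>\<Phi> x\<bar> \<noteq> \<infinity>"
  using assms unfolding legendre_def effdom_def by auto

lemma legendre_gderiv:
  assumes "legendre \<Phi>" "x \<in> intdom \<Phi>"
  shows "GDERIV (\<lambda>y. real_of_ereal (\<Phi> y)) x :> grad \<Phi> x"
proof -
  have "(\<lambda>y. real_of_ereal (\<Phi> y)) differentiable (at x)"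
    using assms unfolding legendre_def by auto
  then obtain F where F: "((\<lambda>y. real_of_ereal (\<Phi> y)) has_derivative F) (at x)"
    unfolding differentiable_def by auto
  then have lin: "linear F"
    by (simp add: has_derivative_linear)
  define v where "v = adjoint F 1"
  have "F h = h \<bullet> v" for h
    using adjoint_works[OF lin, of h 1] by (simp add: v_def inner_commute)
  then have "F = (\<lambda>h. h \<bullet> v)"
    by (rule ext)
  then have v: "GDERIV (\<lambda>y. real_of_ereal (\<Phi> y)) x :> v"
    using F unfolding gderiv_def by simp
  have unique: "w = v" if "GDERIV (\<lambda>y. real_of_ereal (\<Phi> y)) x :> w" for w
  proof -
    have "(\<lambda>h. h \<bullet> w) = (\<lambda>h. h \<bullet> v)"
      by (rule has_derivative_unique[OF that[unfolded gderiv_def] v[unfolded gderiv_def]])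
    then show ?thesis
      by (subst vector_eq_ldot[symmetric]) (auto dest: fun_cong)
  qed
  show ?thesis
    unfolding grad_def by (rule theI[of _ v]) (auto intro: v unique)
qed

lemma legendre_directional_limit:
  assumes "legendre \<Phi>" "x \<in> intdom \<Phi>"
  shows "((\<lambda>s. (real_of_ereal (\<Phi> (x + s *\<^sub>R h)) - real_of_ereal (\<Phi> x)) / s)
           \<longlongrightarrow> grad \<Phi> x \<bullet> h) (at 0)"
proof -
  have 1: "((\<lambda>y. real_of_ereal (\<Phi> y)) has_derivative (\<lambda>k. k \<bullet> grad \<Phi> x)) (at (x + 0 *\<^sub>R h))"
    using legendre_gderiv[OF assms] unfolding gderiv_def by simp
  have 2: "((\<lambda>s::real. x + s *\<^sub>R h) has_derivative (\<lambda>s. s *\<^sub>R h)) (at 0)"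
    by (auto intro!: derivative_eq_intros)
  have "((\<lambda>s. real_of_ereal (\<Phi> (x + s *\<^sub>R h))) has_derivative (\<lambda>s. (s *\<^sub>R h) \<bullet> grad \<Phi> x)) (at 0)"
    using diff_chain_at[OF 2, of "\<lambda>y. real_of_ereal (\<Phi> y)" "\<lambda>k. k \<bullet> grad \<Phi> x"] 1
    by (simp add: o_def)
  then have "((\<lambda>s. real_of_ereal (\<Phi> (x + s *\<^sub>R h))) has_field_derivative (grad \<Phi> x \<bullet> h)) (at 0)"
    unfolding has_field_derivative_def
    by (rule has_derivative_eq_rhs) (auto simp: inner_commute)
  then show ?thesis
    by (simp add: has_field_derivative_iff)
qed

text \<open>
  The only way in which differentiability enters the convexity arguments below: an inequality along
  the segment from \<open>x\<close> in direction \<open>h\<close> that is an equality at \<open>s = 0\<close> may be divided by \<open>s\<close> and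
  passed to the limit \<open>s \<rightarrow> 0\<close>.
\<close>

lemma legendre_slope_inequality:
  assumes "legendre \<Phi>" "x \<in> intdom \<Phi>"
    and le: "\<And>s. 0 < s \<Longrightarrow> s < 1 \<Longrightarrow>
      0 \<le> c * (real_of_ereal (\<Phi> (x + s *\<^sub>R h)) - real_of_ereal (\<Phi> x)) + s * K"
  shows "0 \<le> c * (grad \<Phi> x \<bullet> h) + K"
proof (rule tendsto_lowerbound)
  show "((\<lambda>s. c * ((real_of_ereal (\<Phi> (x + s *\<^sub>R h)) - real_of_ereal (\<Phi> x)) / s) + K)
           \<longlongrightarrow> c * (grad \<Phi> x \<bullet> h) + K) (at_right 0)"
    by (intro tendsto_intros tendsto_within_subset[OF legendre_directional_limit[OF assms(1,2)]]) auto
  have "0 \<le> c * ((real_of_ereal (\<Phi> (x + s *\<^sub>R h)) - real_of_ereal (\<Phi> x)) / s) + K"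
    if "0 < s" "s < 1" for s
  proof -
    have "0 \<le> (c * (real_of_ereal (\<Phi> (x + s *\<^sub>R h)) - real_of_ereal (\<Phi> x)) + s * K) / s"
      using le[OF that] that by simp
    also have "\<dots> = c * ((real_of_ereal (\<Phi> (x + s *\<^sub>R h)) - real_of_ereal (\<Phi> x)) / s) + K"
      using that by (simp add: field_simps)
    finally show ?thesis .
  qed
  then show "\<forall>\<^sub>F s in at_right 0.
      0 \<le> c * ((real_of_ereal (\<Phi> (x + s *\<^sub>R h)) - real_of_ereal (\<Phi> x)) / s) + K"
    unfolding eventually_at_right_field by (intro exI[of _ 1]) auto
qed simp

lemma bregman_eq_ereal:
  assumes "legendre \<Phi>" "x \<in> effdom \<Phi>" "y \<in> effdom \<Phi>"
  shows "bregman \<Phi> y x =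
    ereal (real_of_ereal (\<Phi> y) - real_of_ereal (\<Phi> x) - grad \<Phi> x \<bullet> (y - x))"
  using legendre_abs_finite[OF assms(1,2)] legendre_abs_finite[OF assms(1,3)]
  unfolding bregman_def by (cases "\<Phi> x"; cases "\<Phi> y") auto

lemma bregman_eq_infinity:
  assumes "legendre \<Phi>" "x \<in> effdom \<Phi>" "y \<notin> effdom \<Phi>"
  shows "bregman \<Phi> y x = \<infinity>"
  using legendre_abs_finite[OF assms(1,2)] assms(3)
  unfolding bregman_def effdom_def by (cases "\<Phi> x") auto

lemma bregman_self:
  assumes "legendre \<Phi>" "x \<in> effdom \<Phi>"
  shows "bregman \<Phi> x x = 0"
  using bregman_eq_ereal[OF assms assms(2)] by (simp add: zero_ereal_def)

lemma bregman_nonneg: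
  assumes L: "legendre \<Phi>" and x: "x \<in> intdom \<Phi>"
  shows "0 \<le> bregman \<Phi> y x"
proof (cases "y \<in> effdom \<Phi>")
  case False
  then show ?thesis
    using bregman_eq_infinity[OF L _ False] x interior_subset by fastforce
next
  case y: True
  have x': "x \<in> effdom \<Phi>"
    using x interior_subset by blast
  show ?thesis
  proof (cases "y = x")
    case True
    then show ?thesis
      using bregman_self[OF L x'] by simp
  next
    case False
    have "0 \<le> (-1) * (grad \<Phi> x \<bullet> (y - x)) + (real_of_ereal (\<Phi> y) - real_of_ereal (\<Phi> x))"
    proof (rule legendre_slope_inequality[OF L x])
      fix s :: real
      assume s: "0 < s" "s < 1"
      have eq: "x + s *\<^sub>R (y - x) = (1 - s) *\<^sub>R x + s *\<^sub>R y"
        by (simp add: algebra_simps)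
      have le: "\<Phi> (x + s *\<^sub>R (y - x)) < ereal (1 - s) * \<Phi> x + ereal s * \<Phi> y"
        using L x' y s False unfolding eq legendre_def strictly_convex_fun_def by auto
      have "x + s *\<^sub>R (y - x) \<in> effdom \<Phi>"
        using L x' y s unfolding eq legendre_def strictly_convex_fun_def convex_def by auto
      note finite = legendre_abs_finite[OF L this] legendre_abs_finite[OF L x'] legendre_abs_finite[OF L y]
      obtain a b c where "\<Phi> x = ereal a" "\<Phi> y = ereal b" "\<Phi> (x + s *\<^sub>R (y - x)) = ereal c"
        using finite by (metis abs_neq_infinity_cases)
      then have "real_of_ereal (\<Phi> (x + s *\<^sub>R (y - x)))
          < (1 - s) * real_of_ereal (\<Phi> x) + s * real_of_ereal (\<Phi> y)"
        using le by simp
      then show "0 \<le> (-1) * (real_of_ereal (\<Phi> (x + s *\<^sub>R (y - x))) - real_of_ereal (\<Phi> x))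
          + s * (real_of_ereal (\<Phi> y) - real_of_ereal (\<Phi> x))"
        by (simp add: algebra_simps)
    qed
    then show ?thesis
      unfolding bregman_eq_ereal[OF L x' y] by simp
  qed
qed

text \<open>
  The proximal inequality behind every mirror-descent type analysis. The function minimized by \<open>z\<close>
  differs from \<open>(c - \<rho>) \<Phi>\<close> by \<open>g + \<rho> \<Phi>\<close> plus an affine function, that is, by a convex function, so that it
  is "\<open>(c - \<rho>)\<close>-strongly convex relative to \<open>\<Phi>\<close>". Comparing \<open>z\<close> with the points of the segment from
  \<open>z\<close> to \<open>y\<close> and letting these tend to \<open>z\<close> turns minimality into growth by \<open>(c - \<rho>) D(y, z)\<close>: the
  convexity inequality bounds the values of \<open>g\<close>, and only \<open>\<Phi>\<close> is differentiated.
\<close>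

lemma bregman_three_point:
  fixes \<Phi> :: "'a::euclidean_space \<Rightarrow> ereal"
  assumes L: "legendre \<Phi>" and conv: "rel_weakly_convex_on (intdom \<Phi>) \<Phi> \<rho> g"
    and proper: "\<And>v. g v \<noteq> -\<infinity>"
    and min: "is_arg_min (\<lambda>v. g v + ereal c * bregman \<Phi> v x) (\<lambda>v. v \<in> intdom \<Phi>) z"
    and x: "x \<in> intdom \<Phi>" and y: "y \<in> intdom \<Phi>" and gy: "g y < \<infinity>" and gz: "g z < \<infinity>"
  shows "real_of_ereal (g z) + c * real_of_ereal (bregman \<Phi> z x)
      + (c - \<rho>) * real_of_ereal (bregman \<Phi> y z)
    \<le> real_of_ereal (g y) + c * real_of_ereal (bregman \<Phi> y x)"
proof -
  define \<phi> where "\<phi> = (\<lambda>v. real_of_ereal (\<Phi> v))"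
  define D where "D = (\<lambda>v w. \<phi> v - \<phi> w - grad \<Phi> w \<bullet> (v - w))"
  have z: "z \<in> intdom \<Phi>"
    using min by (simp add: is_arg_min_def)
  have sub: "v \<in> effdom \<Phi>" if "v \<in> intdom \<Phi>" for v
    using that interior_subset by blast
  have \<Phi>_eq: "\<Phi> v = ereal (\<phi> v)" if "v \<in> intdom \<Phi>" for v
    using legendre_abs_finite[OF L sub[OF that]] by (simp add: \<phi>_def ereal_real)
  have D_eq: "bregman \<Phi> v w = ereal (D v w)" if "v \<in> intdom \<Phi>" "w \<in> intdom \<Phi>" for v w
    using bregman_eq_ereal[OF L sub sub] that by (simp add: D_def \<phi>_def)
  obtain a where a: "g z = ereal a"
    using gz proper[of z] by (cases "g z") auto
  obtain b where b: "g y = ereal b"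
    using gy proper[of y] by (cases "g y") auto
  have cU: "convex (intdom \<Phi>)"
    using conv unfolding rel_weakly_convex_on_def convex_fun_on_def by simp
  have "0 \<le> (c - \<rho>) * (grad \<Phi> z \<bullet> (y - z))
      + (b - a + c * (D y x - D z x) - (c - \<rho>) * (\<phi> y - \<phi> z))"
  proof (rule legendre_slope_inequality[OF L z])
    fix s :: real
    assume s: "0 < s" "s < 1"
    define w where "w = (1 - s) *\<^sub>R z + s *\<^sub>R y"
    have w: "w \<in> intdom \<Phi>"
      using cU y z s unfolding w_def convex_def by auto
    have w': "z + s *\<^sub>R (y - z) = w"
      by (simp add: w_def algebra_simps)
    have "g w + ereal \<rho> * \<Phi> w \<le> ereal (1 - s) * (g z + ereal \<rho> * \<Phi> z) + ereal s * (g y + ereal \<rho> * \<Phi> y)"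
      using conv y z s unfolding rel_weakly_convex_on_def convex_fun_on_def w_def by auto
    then have "g w + ereal (\<rho> * \<phi> w) \<le> ereal ((1 - s) * (a + \<rho> * \<phi> z) + s * (b + \<rho> * \<phi> y))"
      by (simp add: \<Phi>_eq w y z a b)
    then obtain q where q: "g w = ereal q"
        "q + \<rho> * \<phi> w \<le> (1 - s) * (a + \<rho> * \<phi> z) + s * (b + \<rho> * \<phi> y)"
      using proper[of w] by (cases "g w") auto
    have "g z + ereal c * bregman \<Phi> z x \<le> g w + ereal c * bregman \<Phi> w x"
      using min w unfolding is_arg_min_def by (auto simp: not_less)
    then have "a + c * D z x \<le> q + c * D w x"
      by (simp add: a q D_eq w z x)
    (* D(., x) and \<Phi> differ by an affine function, so their convexity defects agree. *)
    moreover have "D w x = (1 - s) * D z x + s * D y x + (\<phi> w - (1 - s) * \<phi> z - s * \<phi> y)"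
    proof -
      have "w - x = (1 - s) *\<^sub>R (z - x) + s *\<^sub>R (y - x)"
        by (simp add: w_def algebra_simps)
      then have "grad \<Phi> x \<bullet> (w - x)
          = (1 - s) * (grad \<Phi> x \<bullet> (z - x)) + s * (grad \<Phi> x \<bullet> (y - x))"
        by (simp only: inner_add_right inner_scaleR_right)
      then show ?thesis
        unfolding D_def by (simp add: algebra_simps)
    qed
    ultimately have "a + c * D z x \<le> (1 - s) * (a + \<rho> * \<phi> z) + s * (b + \<rho> * \<phi> y) - \<rho> * \<phi> w
        + c * ((1 - s) * D z x + s * D y x + (\<phi> w - (1 - s) * \<phi> z - s * \<phi> y))"
      using q(2) by simp
    then show "0 \<le> (c - \<rho>) * (real_of_ereal (\<Phi> (z + s *\<^sub>R (y - z))) - real_of_ereal (\<Phi> z))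
        + s * (b - a + c * (D y x - D z x) - (c - \<rho>) * (\<phi> y - \<phi> z))"
      unfolding w' \<phi>_def[symmetric] by (simp add: \<phi>_def[symmetric, THEN fun_cong] algebra_simps)
  qed
  then have "a + c * D z x + (c - \<rho>) * D y z \<le> b + c * D y x"
    unfolding D_def by (simp add: algebra_simps)
  then show ?thesis
    by (simp add: a b D_eq x y z)
qed

section \<open>Measurability of the Bregman divergence\<close>

lemma legendre_borel_measurable:
  "legendre \<Phi> \<Longrightarrow> \<Phi> \<in> borel_measurable borel"
  unfolding legendre_def by (simp add: closed_fun_borel_measurable)

text \<open>
  Each coordinate of the gradient is a pointwise limit of difference quotients. The real-valued version
  of \<open>\<Phi>\<close> is Borel on the whole space, so it does not matter that \<open>x + b / n\<close> may leave the interior of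
  the domain for small \<open>n\<close>.
\<close>

lemma grad_borel_measurable:
  assumes L: "legendre \<Phi>"
  shows "grad \<Phi> \<in> borel_measurable (restrict_space borel (intdom \<Phi>))"
proof (subst borel_measurable_euclidean_space, intro ballI)
  fix b :: 'a
  note legendre_borel_measurable[OF L, measurable]
  have 1: "(\<lambda>x. (real_of_ereal (\<Phi> (x + (1 / real (Suc n)) *\<^sub>R b)) - real_of_ereal (\<Phi> x)) / (1 / real (Suc n)))
      \<in> borel_measurable (restrict_space borel (intdom \<Phi>))" for n
    by (rule measurable_restrict_space1) measurable
  have 2: "(\<lambda>n. (real_of_ereal (\<Phi> (x + (1 / real (Suc n)) *\<^sub>R b)) - real_of_ereal (\<Phi> x)) / (1 / real (Suc n)))
      \<longlonglongrightarrow> grad \<Phi> x \<bullet> b" if "x \<in> space (restrict_space borel (intdom \<Phi>))" for x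
  proof -
    have x: "x \<in> intdom \<Phi>"
      using that by (simp add: space_restrict_space)
    have "(\<lambda>n. 1 / real (Suc n)) \<longlonglongrightarrow> 0"
      using LIMSEQ_Suc[OF lim_1_over_n[where 'a = real]] .
    then have "filterlim (\<lambda>n. 1 / real (Suc n)) (at 0) sequentially"
      by (rule filterlim_atI) simp
    from filterlim_compose[OF legendre_directional_limit[OF L x, of b] this]
    show ?thesis .
  qed
  show "(\<lambda>x. grad \<Phi> x \<bullet> b) \<in> borel_measurable (restrict_space borel (intdom \<Phi>))"
    by (rule borel_measurable_LIMSEQ_real[OF 2 1])
qed

lemma bregman_borel_measurable:
  assumes L: "legendre \<Phi>"
    and p: "p \<in> borel_measurable N" and q: "q \<in> N \<rightarrow>\<^sub>M restrict_space borel (intdom \<Phi>)"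
  shows "(\<lambda>\<omega>. bregman \<Phi> (p \<omega>) (q \<omega>)) \<in> borel_measurable N"
proof -
  note legendre_borel_measurable[OF L, measurable] p[measurable]
  have [measurable]: "q \<in> borel_measurable N"
    using q by (simp add: measurable_restrict_space2_iff)
  have [measurable]: "(\<lambda>\<omega>. grad \<Phi> (q \<omega>)) \<in> borel_measurable N"
    using measurable_compose[OF q grad_borel_measurable[OF L]] .
  show ?thesis
    unfolding bregman_def by measurable
qed

section \<open>One proximal step, sample by sample\<close>

lemma envelope_ge:
  assumes "legendre \<Phi>" "x \<in> intdom \<Phi>" "0 < lam" and le: "\<And>y. c \<le> F y"
  shows "c \<le> envelope \<Phi> F lam x"
  unfolding envelope_def
proof (rule INF_greatest)
  fix y
  have "0 \<le> ereal (1 / lam) * bregman \<Phi> y x"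
    using bregman_nonneg[OF assms(1,2), of y] assms(3) by simp
  from add_mono[OF le[of y] this] show "c \<le> F y + ereal (1 / lam) * bregman \<Phi> y x"
    by simp
qed

lemma lipschitz_quadratic_bound:
  fixes l d \<eta> :: real
  assumes "0 < \<eta>" "0 \<le> d"
  shows "l * sqrt d - d / \<eta> \<le> \<eta> * l\<^sup>2 / 4"
proof -
  have "0 \<le> (\<eta> * l / 2 - sqrt d)\<^sup>2 / \<eta>"
    using assms by simp
  also have "\<dots> = \<eta> * l\<^sup>2 / 4 - l * sqrt d + d / \<eta>"
    using assms by (simp add: power2_eq_square field_simps)
  finally show ?thesis
    by simp
qed

text \<open>
  The proximal inequality for the model, compared with an arbitrary point \<open>y\<close> (later the proximal
  point of the true objective). The Lipschitz bound replaces the model value \<open>h z\<close> by \<open>h x\<close> at the price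
  of \<open>l * sqrt (D(z, x))\<close>, which the term \<open>D(z, x) / \<eta>\<close> absorbs up to \<open>\<eta> l\<^sup>2 / 4\<close>. The values of \<open>r\<close> at \<open>y\<close>
  and \<open>z\<close> are kept apart, because only the model, not \<open>r\<close>, is known to be Lipschitz.
\<close>

lemma model_step_bound:
  fixes \<Phi> :: "'a::euclidean_space \<Rightarrow> ereal"
  assumes L: "legendre \<Phi>"
    and conv: "rel_weakly_convex_on (intdom \<Phi>) \<Phi> \<rho> (\<lambda>v. ereal (h v) + r v)"
    and proper: "\<And>v. r v \<noteq> -\<infinity>"
    and min: "is_arg_min (\<lambda>v. ereal (h v) + r v + ereal (1 / \<eta>) * bregman \<Phi> v x) (\<lambda>v. v \<in> intdom \<Phi>) z"
    and lip: "\<And>v. v \<in> intdom \<Phi> \<inter> effdom r \<Longrightarrow> h x - h v \<le> l * sqrt (real_of_ereal (bregman \<Phi> v x))"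
    and x: "x \<in> intdom \<Phi> \<inter> effdom r" and y: "y \<in> intdom \<Phi> \<inter> effdom r" and \<eta>: "0 < \<eta>"
  shows "z \<in> intdom \<Phi> \<inter> effdom r"
    and "(1 / \<eta> - \<rho>) * real_of_ereal (bregman \<Phi> y z) + real_of_ereal (r z)
      \<le> h y - h x + \<eta> * l\<^sup>2 / 4 + real_of_ereal (r y) + real_of_ereal (bregman \<Phi> y x) / \<eta>"
proof -
  have sub: "v \<in> effdom \<Phi>" if "v \<in> intdom \<Phi>" for v
    using that interior_subset by blast
  have z: "z \<in> intdom \<Phi>"
    using min by (simp add: is_arg_min_def)
  have "ereal (h z) + r z + ereal (1 / \<eta>) * bregman \<Phi> z x
      \<le> ereal (h x) + r x + ereal (1 / \<eta>) * bregman \<Phi> x x"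
    using min x unfolding is_arg_min_def by (auto simp: not_less)
  also have "\<dots> < \<infinity>"
    using x bregman_self[OF L sub] by (auto simp: effdom_def)
  finally have rz: "r z < \<infinity>"
    using \<eta> bregman_nonneg[OF L, of x z] x by (cases "bregman \<Phi> z x") auto
  then show zr: "z \<in> intdom \<Phi> \<inter> effdom r"
    using z by (simp add: effdom_def)
  obtain a b where ab: "r z = ereal a" "r y = ereal b"
    using rz y proper[of z] proper[of y] by (cases "r z"; cases "r y") (auto simp: effdom_def)
  define D where "D = (\<lambda>v w. real_of_ereal (bregman \<Phi> v w))"
  have "h z + a + 1 / \<eta> * D z x + (1 / \<eta> - \<rho>) * D y z \<le> h y + b + 1 / \<eta> * D y x"
    using bregman_three_point[OF L conv _ min, of y] x y rz proper
    by (auto simp: D_def ab effdom_def)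
  moreover have "h x - h z \<le> l * sqrt (D z x)"
    using lip[OF zr] by (simp add: D_def)
  moreover have "l * sqrt (D z x) - D z x / \<eta> \<le> \<eta> * l\<^sup>2 / 4"
    using lipschitz_quadratic_bound[OF \<eta>] bregman_nonneg[OF L, of x z] x
    by (simp add: D_def real_of_ereal_pos)
  ultimately show "(1 / \<eta> - \<rho>) * real_of_ereal (bregman \<Phi> y z) + real_of_ereal (r z)
      \<le> h y - h x + \<eta> * l\<^sup>2 / 4 + real_of_ereal (r y) + real_of_ereal (bregman \<Phi> y x) / \<eta>"
    by (simp add: D_def ab)
qed

section \<open>The expected decrease of the envelope in one step\<close>

text \<open>
  The lower bounds \<open>r\<^sub>l\<^sub>o\<^sub>w\<close> and \<open>F\<^sub>l\<^sub>o\<^sub>w\<close> will be the infima of \<open>r\<close> and of the objective. They are real numbers, so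
  this setting covers the case where \<open>r\<close> is bounded below; otherwise the bound to be proved is infinite.
\<close>

locale stochastic_model_problem = prob_space P
  for P :: "'s measure" +
  fixes \<Phi> r :: "'a::euclidean_space \<Rightarrow> ereal"
    and f :: "'a \<Rightarrow> real"
    and m :: "'a \<Rightarrow> 'a \<Rightarrow> 's \<Rightarrow> real"
    and S :: "real \<Rightarrow> 'a \<Rightarrow> 's \<Rightarrow> 'a"
    and \<tau> \<rho> C lam :: real
    and r\<^sub>l\<^sub>o\<^sub>w F\<^sub>l\<^sub>o\<^sub>w :: real
  assumes legendre: "legendre \<Phi>"
    and composite: "composite_problem \<Phi> f r"
    and \<tau>_pos: "0 < \<tau>" and \<rho>_pos: "0 < \<rho>"
    and accurate: "one_sided_accurate P \<Phi> f r m \<tau>"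
    and weakly_convex: "weakly_convex_models P \<Phi> r m \<rho>"
    and lipschitz: "lipschitz_models P \<Phi> r m C"
    and solvable: "prox_solvable \<Phi> (objective f r) (inverse (\<tau> + \<rho>))"
    and argmin_map: "model_argmin_map P \<Phi> r m (inverse (\<tau> + \<rho>)) S"
    and lam_pos: "0 < lam" and lam_less: "lam < inverse (\<tau> + \<rho>)"
    and r_lower: "\<And>x. ereal r\<^sub>l\<^sub>o\<^sub>w \<le> r x"
    and F_lower: "\<And>x. ereal F\<^sub>l\<^sub>o\<^sub>w \<le> objective f r x"
begin

abbreviation U_borel :: "'a measure" where
  "U_borel \<equiv> restrict_space borel (intdom \<Phi>)"

abbreviation Env :: "'a \<Rightarrow> ereal" where
  "Env \<equiv> envelope \<Phi> (objective f r) lam"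

abbreviation pr :: "'a \<Rightarrow> 'a" where
  "pr \<equiv> prox \<Phi> (objective f r) lam"

text \<open>
  The three quantities tracked along the iteration are extended nonnegative reals. Their expectations
  then always exist, and points outside the domain of \<open>r\<close> are
  covered by the value \<open>\<top>\<close> of \<open>reg_gap\<close>.
\<close>

definition env_gap :: "'a \<Rightarrow> ennreal" where
  "env_gap x = e2ennreal (Env x - ereal F\<^sub>l\<^sub>o\<^sub>w)"

definition reg_gap :: "'a \<Rightarrow> ennreal" where
  "reg_gap x = e2ennreal (r x - ereal r\<^sub>l\<^sub>o\<^sub>w)"

definition prox_gap :: "'a \<Rightarrow> ennreal" where
  "prox_gap x = e2ennreal (bregman \<Phi> (pr x) x)"

definition step_weight :: "real \<Rightarrow> real" where
  "step_weight \<eta> = \<eta> / (1 - \<eta> * \<rho>)"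

definition descent_rate :: real where
  "descent_rate = (1 - lam * (\<tau> + \<rho>)) / lam\<^sup>2"

lemma intdom_subset: "x \<in> intdom \<Phi> \<Longrightarrow> x \<in> effdom \<Phi>"
  using interior_subset by blast

lemma space_U_borel: "space U_borel = intdom \<Phi>"
  by (simp add: space_restrict_space)

lemma r_proper: "r x \<noteq> -\<infinity>"
  using composite unfolding composite_problem_def by simp

lemma prox_measurable: "pr \<in> U_borel \<rightarrow>\<^sub>M U_borel"
  using solvable lam_pos lam_less unfolding prox_solvable_def by simp

lemma prox_intdom: "x \<in> intdom \<Phi> \<Longrightarrow> pr x \<in> intdom \<Phi>"
  using measurable_space[OF prox_measurable] by (simp add: space_U_borel)

lemma envelope_eq_prox:
  assumes "x \<in> intdom \<Phi>"
  shows "Env x = objective f r (pr x) + ereal (1 / lam) * bregman \<Phi> (pr x) x"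
proof -
  have "is_arg_min (\<lambda>y. objective f r y + ereal (1 / lam) * bregman \<Phi> y x) (\<lambda>y. y \<in> UNIV) (pr x)"
    using solvable lam_pos lam_less assms unfolding prox_solvable_def unique_min_on_def by simp
  then show ?thesis
    unfolding envelope_def is_arg_min_def
    by (intro antisym INF_lower INF_greatest) (auto simp: not_less)
qed

lemma envelope_le: "Env x \<le> objective f r y + ereal (1 / lam) * bregman \<Phi> y x"
  unfolding envelope_def by (rule INF_lower) simp

lemma envelope_lower: "x \<in> intdom \<Phi> \<Longrightarrow> ereal F\<^sub>l\<^sub>o\<^sub>w \<le> Env x"
  by (rule envelope_ge[OF legendre _ lam_pos F_lower])

lemma envelope_le_objective:
  assumes "x \<in> intdom \<Phi>"
  shows "Env x \<le> objective f r x"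
  using envelope_le[of x x] bregman_self[OF legendre intdom_subset[OF assms]] by simp

lemma prox_effdom:
  assumes x: "x \<in> intdom \<Phi> \<inter> effdom r"
  shows "pr x \<in> intdom \<Phi> \<inter> effdom r"
proof -
  have "objective f r (pr x) + ereal (1 / lam) * bregman \<Phi> (pr x) x \<le> objective f r x"
    using envelope_le_objective envelope_eq_prox x by force
  also have "\<dots> < \<infinity>"
    using x by (simp add: effdom_def objective_def)
  finally have "r (pr x) < \<infinity>"
    using bregman_nonneg[OF legendre, of x "pr x"] x lam_pos
    by (cases "bregman \<Phi> (pr x) x"; cases "r (pr x)") (auto simp: objective_def)
  then show ?thesis
    using prox_intdom x by (simp add: effdom_def)
qed

lemma step_weight_pos:
  assumes "0 < \<eta>" "\<eta> < lam"
  shows "\<eta> * \<rho> < 1" "0 < step_weight \<eta>"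
proof -
  have "\<eta> * \<rho> \<le> lam * \<rho>"
    using assms \<rho>_pos by simp
  also have "\<dots> < 1"
    using lam_less lam_pos \<tau>_pos \<rho>_pos
    by (smt (verit, best) inverse_eq_divide less_divide_eq mult_strict_left_mono)
  finally show "\<eta> * \<rho> < 1" .
  then show "0 < step_weight \<eta>"
    using assms by (simp add: step_weight_def)
qed

lemma step_weight_mono:
  assumes "0 < \<eta>'" "\<eta>' \<le> \<eta>" "\<eta> < lam"
  shows "step_weight \<eta>' \<le> step_weight \<eta>"
  unfolding step_weight_def
proof (rule frac_le)
  show "0 < 1 - \<eta> * \<rho>"
    using step_weight_pos(1)[of \<eta>] assms by simp
qed (use assms \<rho>_pos in auto)

lemma descent_rate_pos: "0 < descent_rate"
proof -
  have "lam * (\<tau> + \<rho>) < 1"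
    using lam_less \<tau>_pos \<rho>_pos by (simp add: inverse_eq_divide less_divide_eq)
  then show ?thesis
    using lam_pos by (simp add: descent_rate_def)
qed

lemma reg_gap_measurable: "reg_gap \<in> borel_measurable U_borel"
proof -
  have [measurable]: "r \<in> borel_measurable borel"
    using composite unfolding composite_problem_def by (simp add: closed_fun_borel_measurable)
  show ?thesis
    unfolding reg_gap_def by (rule measurable_restrict_space1) measurable
qed

lemma prox_gap_measurable: "prox_gap \<in> borel_measurable U_borel"
proof -
  have "pr \<in> borel_measurable U_borel"
    using prox_measurable by (simp add: measurable_restrict_space2_iff)
  from bregman_borel_measurable[OF legendre this measurable_ident]
  show ?thesis
    unfolding prox_gap_def id_def by measurable
qed

lemma env_gap_measurable: "env_gap \<in> borel_measurable U_borel"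
proof -
  have "isCont f x" for x
  proof -
    obtain e K where "e > 0" "K-lipschitz_on (ball x e) f"
      using composite unfolding composite_problem_def locally_lipschitz_def by blast
    then show ?thesis
      using lipschitz_on_continuous_on continuous_on_eq_continuous_at[of "ball x e" f] by fastforce
  qed
  then have [measurable]: "f \<in> borel_measurable borel"
    by (intro borel_measurable_continuous_onI continuous_at_imp_continuous_on) auto
  have [measurable]: "r \<in> borel_measurable borel"
    using composite unfolding composite_problem_def by (simp add: closed_fun_borel_measurable)
  have [measurable]: "objective f r \<in> borel_measurable borel"
    unfolding objective_def[abs_def] by measurable
  have p[measurable]: "pr \<in> borel_measurable U_borel"
    using prox_measurable by (simp add: measurable_restrict_space2_iff)
  have [measurable]: "(\<lambda>x. bregman \<Phi> (pr x) x) \<in> borel_measurable U_borel"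
    using bregman_borel_measurable[OF legendre p measurable_ident] by (simp add: id_def)
  have "(\<lambda>x. e2ennreal (objective f r (pr x) + ereal (1 / lam) * bregman \<Phi> (pr x) x - ereal F\<^sub>l\<^sub>o\<^sub>w))
      \<in> borel_measurable U_borel"
    by measurable
  then show ?thesis
    by (rule measurable_cong[THEN iffD1, rotated])
      (simp add: env_gap_def envelope_eq_prox space_U_borel)
qed

text \<open>
  Let \<open>y\<close> be the proximal point of \<open>x\<close> and \<open>z\<close> the random next iterate. The envelope at \<open>z\<close> is at most
  \<open>F y + D(y, z) / lam\<close>, and the model inequality bounds \<open>D(y, z)\<close> by model values at \<open>y\<close> and \<open>x\<close>. On
  average these are at most \<open>f y + \<tau> D(y, x)\<close> and exactly \<open>f x\<close>, and \<open>F y + D(y, x) / lam \<le> F x\<close> by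
  definition of \<open>y\<close>. Collecting the multiples of \<open>D(y, x)\<close> leaves the negative coefficient
  \<open>- descent_rate * step_weight \<eta>\<close>. The difference of \<open>r\<close> between \<open>x\<close> and \<open>z\<close> survives and appears as
  \<open>reg_gap\<close> on both sides, with equal coefficients.
\<close>

lemma expected_step:
  assumes x: "x \<in> intdom \<Phi>" and \<eta>: "0 < \<eta>" "\<eta> < lam"
  shows "(\<integral>\<^sup>+\<xi>. env_gap (S \<eta> x \<xi>) + ennreal (step_weight \<eta> / lam) * reg_gap (S \<eta> x \<xi>) \<partial>P)
      + ennreal (descent_rate * step_weight \<eta>) * prox_gap x
    \<le> env_gap x + ennreal (step_weight \<eta> / lam) * reg_gap x
      + ennreal (C\<^sup>2 * (\<eta>\<^sup>2 / (4 * lam * (1 - \<eta> * \<rho>))))"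
proof (cases "x \<in> effdom r")
  case False
  then have "reg_gap x = \<top>"
    by (simp add: reg_gap_def effdom_def)
  then show ?thesis
    using step_weight_pos(2)[OF \<eta>] lam_pos by (simp add: ennreal_mult_top)
next
  case True
  then have xr: "x \<in> intdom \<Phi> \<inter> effdom r"
    using x by simp
  define y where "y = pr x"
  have yr: "y \<in> intdom \<Phi> \<inter> effdom r"
    unfolding y_def by (rule prox_effdom[OF xr])
  obtain a where a: "r x = ereal a"
    using r_proper[of x] True by (cases "r x") (auto simp: effdom_def)
  obtain b where b: "r y = ereal b"
    using r_proper[of y] yr by (cases "r y") (auto simp: effdom_def)
  obtain d where d: "bregman \<Phi> y x = ereal d" and d0: "0 \<le> d"
    using bregman_eq_ereal[OF legendre intdom_subset intdom_subset, of x y]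
      bregman_nonneg[OF legendre x, of y] xr yr by auto
  have env: "Env x = ereal (f y + b + d / lam)"
    using envelope_eq_prox[OF x] by (simp add: y_def[symmetric] objective_def b d)
  have env_le: "f y + b + d / lam \<le> f x + a"
    using envelope_le_objective[OF x] by (simp add: env objective_def a)
  obtain L where L: "L \<in> borel_measurable P" "\<And>\<xi>. \<xi> \<in> space P \<Longrightarrow> 0 \<le> L \<xi>"
      "integrable P (\<lambda>\<xi>. (L \<xi>)\<^sup>2)" "sqrt (\<integral>\<xi>. (L \<xi>)\<^sup>2 \<partial>P) \<le> C"
      "\<And>v \<xi>. v \<in> intdom \<Phi> \<inter> effdom r \<Longrightarrow> \<xi> \<in> space P \<Longrightarrow>
         m x x \<xi> - m x v \<xi> \<le> L \<xi> * sqrt (real_of_ereal (bregman \<Phi> v x))"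
    using lipschitz xr unfolding lipschitz_models_def by blast
  have L2: "(\<integral>\<xi>. (L \<xi>)\<^sup>2 \<partial>P) \<le> C\<^sup>2"
    using sqrt_le_D[OF L(4)] .
  have mx: "integrable P (m x x)" "(\<integral>\<xi>. m x x \<xi> \<partial>P) = f x"
    and my: "integrable P (m x y)" "ereal (\<integral>\<xi>. m x y \<xi> - f y \<partial>P) \<le> ereal \<tau> * bregman \<Phi> y x"
    using accurate xr yr unfolding one_sided_accurate_def by blast+
  have my': "(\<integral>\<xi>. m x y \<xi> \<partial>P) \<le> f y + \<tau> * d"
    using my by (simp add: d prob_space)
  define w where "w = step_weight \<eta>"
  have w: "0 < w" "1 / \<eta> - \<rho> = 1 / w"
    using step_weight_pos[OF \<eta>] \<eta> by (simp_all add: w_def step_weight_def field_simps)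
  (* Q \<xi> bounds the two gaps at the next iterate for the sample \<xi>; unlike these it is a linear
     expression in integrable functions of \<xi>, so its expectation can be computed. *)
  define Q where "Q = (\<lambda>\<xi>. f y + b - F\<^sub>l\<^sub>o\<^sub>w + (w / lam) *
      (m x y \<xi> - m x x \<xi> + \<eta> * (L \<xi>)\<^sup>2 / 4 + b + d / \<eta> - r\<^sub>l\<^sub>o\<^sub>w))"
  have \<eta>': "\<eta> < inverse (\<tau> + \<rho>)"
    using \<eta> lam_less by simp
  have "AE \<xi> in P. rel_weakly_convex_on (intdom \<Phi>) \<Phi> \<rho> (\<lambda>v. ereal (m x v \<xi>) + r v)"
    using weakly_convex xr unfolding weakly_convex_models_def by blast
  moreover have "AE \<xi> in P. unique_min_on (\<lambda>v. ereal (m x v \<xi>) + r v + ereal (1 / \<eta>) * bregman \<Phi> v x)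
      (intdom \<Phi>) (S \<eta> x \<xi>)"
    using argmin_map \<eta> \<eta>' x unfolding model_argmin_map_def by blast
  ultimately have step: "AE \<xi> in P. 0 \<le> Q \<xi> \<and>
      env_gap (S \<eta> x \<xi>) + ennreal (w / lam) * reg_gap (S \<eta> x \<xi>) \<le> ennreal (Q \<xi>)"
    using AE_space
  proof eventually_elim
    case (elim \<xi>)
    define z where "z = S \<eta> x \<xi>"
    have min: "is_arg_min (\<lambda>v. ereal (m x v \<xi>) + r v + ereal (1 / \<eta>) * bregman \<Phi> v x)
        (\<lambda>v. v \<in> intdom \<Phi>) z"
      using elim(2) by (simp add: unique_min_on_def z_def)
    note step = model_step_bound[OF legendre elim(1) r_proper min L(5)[OF _ elim(3)] xr yr \<eta>(1)]
    have zr: "z \<in> intdom \<Phi> \<inter> effdom r"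
      by (rule step(1))
    obtain q where q: "r z = ereal q"
      using r_proper[of z] zr by (cases "r z") (auto simp: effdom_def)
    obtain D where D: "bregman \<Phi> y z = ereal D"
      using bregman_eq_ereal[OF legendre intdom_subset intdom_subset, of z y] zr yr by auto
    have D_le: "D / w + q \<le> m x y \<xi> - m x x \<xi> + \<eta> * (L \<xi>)\<^sup>2 / 4 + b + d / \<eta>"
      using step(2) by (simp add: w(2) D q b d)
    have env_z: "ereal F\<^sub>l\<^sub>o\<^sub>w \<le> Env z" "Env z \<le> ereal (f y + b + D / lam)"
      using envelope_lower[of z] envelope_le[of z y] zr by (simp_all add: objective_def b D)
    then obtain e where e: "Env z = ereal e"
      by (cases "Env z") auto
    have q0: "0 \<le> q - r\<^sub>l\<^sub>o\<^sub>w"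
      using r_lower[of z] by (simp add: q)
    have e0: "0 \<le> e - F\<^sub>l\<^sub>o\<^sub>w"
      using env_z(1) by (simp add: e)
    have wl: "0 \<le> w / lam"
      using w lam_pos by simp
    have "e - F\<^sub>l\<^sub>o\<^sub>w + w / lam * (q - r\<^sub>l\<^sub>o\<^sub>w)
        \<le> f y + b - F\<^sub>l\<^sub>o\<^sub>w + w / lam * (D / w + q - r\<^sub>l\<^sub>o\<^sub>w)"
    proof -
      have "w / lam * (D / w + q - r\<^sub>l\<^sub>o\<^sub>w) = D / lam + w / lam * (q - r\<^sub>l\<^sub>o\<^sub>w)"
        using w lam_pos by (simp add: distrib_left right_diff_distrib)
      then show ?thesis
        using env_z(2) by (simp add: e)
    qed
    also have "\<dots> \<le> Q \<xi>"
      unfolding Q_def using D_le wl by (intro add_left_mono mult_left_mono) simp_all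
    finally have le: "e - F\<^sub>l\<^sub>o\<^sub>w + w / lam * (q - r\<^sub>l\<^sub>o\<^sub>w) \<le> Q \<xi>" .
    have "env_gap z + ennreal (w / lam) * reg_gap z
        = ennreal (e - F\<^sub>l\<^sub>o\<^sub>w + w / lam * (q - r\<^sub>l\<^sub>o\<^sub>w))"
      using e0 q0 wl
      by (simp only: ennreal_plus ennreal_mult mult_nonneg_nonneg)
        (simp add: env_gap_def reg_gap_def e q)
    also have "\<dots> \<le> ennreal (Q \<xi>)"
      by (rule ennreal_leI[OF le])
    finally show ?case
      using le e0 mult_nonneg_nonneg[OF wl q0] unfolding z_def by linarith
  qed
  have intQ: "integrable P Q"
    unfolding Q_def using mx(1) my(1) L(3) by (auto intro!: integrable_add integrable_diff integrable_mult_right)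
  have "(\<integral>\<^sup>+\<xi>. env_gap (S \<eta> x \<xi>) + ennreal (w / lam) * reg_gap (S \<eta> x \<xi>) \<partial>P)
      \<le> (\<integral>\<^sup>+\<xi>. ennreal (Q \<xi>) \<partial>P)"
    using step by (intro nn_integral_mono_AE) auto
  also have "\<dots> = ennreal (\<integral>\<xi>. Q \<xi> \<partial>P)"
    using step by (intro nn_integral_eq_integral intQ) auto
  finally have 1: "(\<integral>\<^sup>+\<xi>. env_gap (S \<eta> x \<xi>) + ennreal (w / lam) * reg_gap (S \<eta> x \<xi>) \<partial>P)
      \<le> ennreal (\<integral>\<xi>. Q \<xi> \<partial>P)" .
  have Q0: "0 \<le> (\<integral>\<xi>. Q \<xi> \<partial>P)"
    using step by (intro integral_nonneg_AE) auto
  have "(\<integral>\<xi>. Q \<xi> \<partial>P) = f y + b - F\<^sub>l\<^sub>o\<^sub>w + (w / lam) *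
      ((\<integral>\<xi>. m x y \<xi> \<partial>P) - f x + \<eta> * (\<integral>\<xi>. (L \<xi>)\<^sup>2 \<partial>P) / 4 + b + d / \<eta> - r\<^sub>l\<^sub>o\<^sub>w)"
    unfolding Q_def using mx my(1) L(3)
    by (simp add: prob_space)
  also have "\<dots> \<le> f y + b - F\<^sub>l\<^sub>o\<^sub>w + (w / lam) *
      ((f y + \<tau> * d) - f x + \<eta> * C\<^sup>2 / 4 + b + d / \<eta> - r\<^sub>l\<^sub>o\<^sub>w)"
    using my' L2 \<eta> w lam_pos
    by (intro add_left_mono mult_left_mono diff_right_mono add_right_mono add_mono divide_right_mono) simp_all
  also have "\<dots> \<le> f y + b - F\<^sub>l\<^sub>o\<^sub>w + (w / lam) *
      (\<tau> * d - d / lam + a + \<eta> * C\<^sup>2 / 4 + d / \<eta> - r\<^sub>l\<^sub>o\<^sub>w)"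
    using env_le w lam_pos by (intro add_left_mono mult_left_mono) simp_all
  (* Split 1/\<eta> + \<tau> - 1/lam as (1/\<eta> - \<rho>) - (1/lam - (\<tau> + \<rho>)): the first part rebuilds the envelope at x,
     the second is the decrease. *)
  also have "\<dots> = f y + b - F\<^sub>l\<^sub>o\<^sub>w + (w / lam) * ((1 / \<eta> - \<rho>) * d)
      + (w / lam) * (a - r\<^sub>l\<^sub>o\<^sub>w) + (w / lam) * (\<eta> * C\<^sup>2 / 4) - (w / lam) * ((1 / lam - (\<tau> + \<rho>)) * d)"
    by (simp add: algebra_simps diff_divide_distrib add_divide_distrib)
  also have "(w / lam) * ((1 / \<eta> - \<rho>) * d) = d / lam"
    using w by simp
  also have "(w / lam) * ((1 / lam - (\<tau> + \<rho>)) * d) = descent_rate * w * d"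
    using lam_pos by (simp add: descent_rate_def power2_eq_square field_simps)
  also have "(w / lam) * (\<eta> * C\<^sup>2 / 4) = C\<^sup>2 * (\<eta>\<^sup>2 / (4 * lam * (1 - \<eta> * \<rho>)))"
    by (simp add: w_def step_weight_def power2_eq_square mult_ac)
  finally have 2: "(\<integral>\<xi>. Q \<xi> \<partial>P) + descent_rate * w * d
      \<le> f y + b + d / lam - F\<^sub>l\<^sub>o\<^sub>w + (w / lam) * (a - r\<^sub>l\<^sub>o\<^sub>w) + C\<^sup>2 * (\<eta>\<^sup>2 / (4 * lam * (1 - \<eta> * \<rho>)))"
    by simp
  have nn: "0 \<le> f y + b + d / lam - F\<^sub>l\<^sub>o\<^sub>w" "0 \<le> a - r\<^sub>l\<^sub>o\<^sub>w" "0 \<le> w / lam" "0 \<le> descent_rate * w"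
      "0 \<le> C\<^sup>2 * (\<eta>\<^sup>2 / (4 * lam * (1 - \<eta> * \<rho>)))"
    using envelope_lower[OF x] r_lower[of x] w lam_pos descent_rate_pos step_weight_pos(1)[OF \<eta>]
    by (simp_all add: env a)
  have "ennreal (\<integral>\<xi>. Q \<xi> \<partial>P) + ennreal (descent_rate * w) * prox_gap x
      = ennreal ((\<integral>\<xi>. Q \<xi> \<partial>P) + descent_rate * w * d)"
    using Q0 nn(4) d0 by (simp add: prox_gap_def y_def[symmetric] d ennreal_plus ennreal_mult)
  also have "\<dots> \<le> ennreal (f y + b + d / lam - F\<^sub>l\<^sub>o\<^sub>w + (w / lam) * (a - r\<^sub>l\<^sub>o\<^sub>w)
      + C\<^sup>2 * (\<eta>\<^sup>2 / (4 * lam * (1 - \<eta> * \<rho>))))"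
    using 2 by (rule ennreal_leI)
  also have "\<dots> = env_gap x + ennreal (w / lam) * reg_gap x + ennreal (C\<^sup>2 * (\<eta>\<^sup>2 / (4 * lam * (1 - \<eta> * \<rho>))))"
  proof -
    have "ennreal (f y + b + d / lam - F\<^sub>l\<^sub>o\<^sub>w + (w / lam) * (a - r\<^sub>l\<^sub>o\<^sub>w)
          + C\<^sup>2 * (\<eta>\<^sup>2 / (4 * lam * (1 - \<eta> * \<rho>))))
        = ennreal (f y + b + d / lam - F\<^sub>l\<^sub>o\<^sub>w) + ennreal (w / lam) * ennreal (a - r\<^sub>l\<^sub>o\<^sub>w)
          + ennreal (C\<^sup>2 * (\<eta>\<^sup>2 / (4 * lam * (1 - \<eta> * \<rho>))))"
      using nn by (simp only: ennreal_plus ennreal_mult add_nonneg_nonneg mult_nonneg_nonneg)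
    then show ?thesis
      by (simp add: env_gap_def reg_gap_def env a)
  qed
  finally show ?thesis
    using add_right_mono[OF 1, of "ennreal (descent_rate * w) * prox_gap x"]
    unfolding w_def by (rule order_trans[rotated])
qed

end

section \<open>Independence and weighted telescoping\<close>

lemma sets_vimage_algebra_comp_subset:
  assumes "X \<in> \<Omega> \<rightarrow> space N" and "u \<in> N \<rightarrow>\<^sub>M K"
  shows "sigma_sets \<Omega> {(\<lambda>\<omega>. u (X \<omega>)) -` A \<inter> \<Omega> | A. A \<in> sets K} \<subseteq> sets (vimage_algebra \<Omega> X N)"
proof -
  have "(\<lambda>\<omega>. u (X \<omega>)) \<in> vimage_algebra \<Omega> X N \<rightarrow>\<^sub>M K"
    using assms by (intro measurable_compose[OF measurable_vimage_algebra1])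
  from measurable_sets[OF this]
  have "{(\<lambda>\<omega>. u (X \<omega>)) -` A \<inter> \<Omega> | A. A \<in> sets K} \<subseteq> sets (vimage_algebra \<Omega> X N)"
    by auto
  from sets.sigma_sets_subset[OF this] show ?thesis
    by simp
qed

text \<open>
  The product rule for two independent variables with values in different spaces. The predicate
  \<open>indep_var\<close> asks for a common type of values, hence independence is expressed by the generated
  \<open>\<sigma>\<close>-algebras and passed on to the numerical variables \<open>u X\<close> and \<open>v Y\<close>.
\<close>

lemma (in prob_space) nn_integral_mult_indep:
  fixes u :: "'b \<Rightarrow> ennreal" and v :: "'c \<Rightarrow> ennreal"
  assumes X: "X \<in> M \<rightarrow>\<^sub>M N" and Y: "Y \<in> M \<rightarrow>\<^sub>M N'"
    and indep: "indep_set (sets (vimage_algebra (space M) X N)) (sets (vimage_algebra (space M) Y N'))"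
    and u: "u \<in> borel_measurable N" and v: "v \<in> borel_measurable N'"
  shows "(\<integral>\<^sup>+\<omega>. u (X \<omega>) * v (Y \<omega>) \<partial>M) = (\<integral>\<^sup>+\<omega>. u (X \<omega>) \<partial>M) * (\<integral>\<^sup>+\<omega>. v (Y \<omega>) \<partial>M)"
proof -
  have "X \<in> space M \<rightarrow> space N" "Y \<in> space M \<rightarrow> space N'"
    using measurable_space[OF X] measurable_space[OF Y] by auto
  from sets_vimage_algebra_comp_subset[OF this(1) u] sets_vimage_algebra_comp_subset[OF this(2) v]
  have "indep_var borel (\<lambda>\<omega>. u (X \<omega>)) borel (\<lambda>\<omega>. v (Y \<omega>))"
    using indep measurable_compose[OF X u] measurable_compose[OF Y v]
    unfolding indep_var_eq indep_sets2_eq by blast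
  moreover have "case_bool borel borel = (\<lambda>_. borel :: ennreal measure)"
    by (auto simp: fun_eq_iff split: bool.split)
  ultimately have "indep_vars (\<lambda>_. borel) (case_bool (\<lambda>\<omega>. u (X \<omega>)) (\<lambda>\<omega>. v (Y \<omega>))) UNIV"
    unfolding indep_var_def by simp
  from indep_vars_nn_integral[OF _ this] show ?thesis
    by (simp add: UNIV_bool mult.commute)
qed

text \<open>
  Summation by parts in the form of an induction. Since the weights \<open>k\<close> are nonincreasing, the term \<open>k n * R (Suc n)\<close>
  left over by step \<open>n\<close> pays for the term \<open>k (Suc n) * R (Suc n)\<close> that step \<open>Suc n\<close> needs. Nothing is
  subtracted, so infinite values do no harm.
\<close>

lemma weighted_telescoping:
  fixes A R k s e :: "nat \<Rightarrow> ennreal"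
  assumes step: "\<And>t. t \<le> T \<Longrightarrow> A (Suc t) + k t * R (Suc t) + s t \<le> A t + k t * R t + e t"
    and k: "\<And>t. k (Suc t) \<le> k t" and n: "n \<le> T"
  shows "A (Suc n) + k n * R (Suc n) + (\<Sum>t\<le>n. s t) \<le> A 0 + k 0 * R 0 + (\<Sum>t\<le>n. e t)"
  using n
proof (induction n)
  case 0
  then show ?case
    using step[of 0] by simp
next
  case (Suc n)
  have "A (Suc (Suc n)) + k (Suc n) * R (Suc (Suc n)) + (\<Sum>t\<le>Suc n. s t)
      = (A (Suc (Suc n)) + k (Suc n) * R (Suc (Suc n)) + s (Suc n)) + (\<Sum>t\<le>n. s t)"
    by (simp add: ac_simps)
  also have "\<dots> \<le> (A (Suc n) + k (Suc n) * R (Suc n) + e (Suc n)) + (\<Sum>t\<le>n. s t)"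
    using step[OF Suc.prems] by (rule add_right_mono)
  also have "\<dots> \<le> (A (Suc n) + k n * R (Suc n) + e (Suc n)) + (\<Sum>t\<le>n. s t)"
    by (intro add_right_mono add_left_mono mult_right_mono k) simp
  also have "\<dots> = (A (Suc n) + k n * R (Suc n) + (\<Sum>t\<le>n. s t)) + e (Suc n)"
    by (simp add: ac_simps)
  also have "\<dots> \<le> (A 0 + k 0 * R 0 + (\<Sum>t\<le>n. e t)) + e (Suc n)"
    using Suc by (intro add_right_mono) simp
  also have "\<dots> = A 0 + k 0 * R 0 + (\<Sum>t\<le>Suc n. e t)"
    by (simp add: ac_simps)
  finally show ?case .
qed

lemma iterate_cong:
  assumes "\<And>i. i < t \<Longrightarrow> z i = z' i"
  shows "iterate S \<eta> x\<^sub>0 z t = iterate S \<eta> x\<^sub>0 z' t"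
  using assms by (induction t) auto

section \<open>The iteration and the random output\<close>

locale stochastic_model_run =
  stochastic_model_problem P \<Phi> r f m S \<tau> \<rho> C lam r\<^sub>l\<^sub>o\<^sub>w F\<^sub>l\<^sub>o\<^sub>w + W: prob_space M
  for P :: "'s measure" and \<Phi> r :: "'a::euclidean_space \<Rightarrow> ereal" and f m S \<tau> \<rho> C lam r\<^sub>l\<^sub>o\<^sub>w F\<^sub>l\<^sub>o\<^sub>w
    and M :: "'w measure" +
  fixes \<eta> :: "nat \<Rightarrow> real" and T :: nat and x\<^sub>0 :: 'a and \<xi> :: "nat \<Rightarrow> 'w \<Rightarrow> 's"
  assumes x0: "x\<^sub>0 \<in> intdom \<Phi>"
    and \<eta>_dec: "decseq \<eta>" and \<eta>_pos: "\<And>t. 0 < \<eta> t" and \<eta>_less: "\<And>t. \<eta> t < lam"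
    and indep: "W.indep_vars (\<lambda>_. P) \<xi> {..T}"
    and distr: "\<And>t. t \<le> T \<Longrightarrow> distr M P (\<xi> t) = P"
begin

abbreviation X :: "nat \<Rightarrow> 'w \<Rightarrow> 'a" where
  "X t \<omega> \<equiv> iterate S \<eta> x\<^sub>0 (\<lambda>i. \<xi> i \<omega>) t"

lemma argmin_measurable: "(\<lambda>(x, s). S (\<eta> t) x s) \<in> U_borel \<Otimes>\<^sub>M P \<rightarrow>\<^sub>M U_borel"
  using argmin_map \<eta>_pos[of t] \<eta>_less[of t] lam_less unfolding model_argmin_map_def by auto

lemma iterate_measurable:
  "{..<t} \<subseteq> I \<Longrightarrow> (\<lambda>z. iterate S \<eta> x\<^sub>0 z t) \<in> PiM I (\<lambda>_. P) \<rightarrow>\<^sub>M U_borel"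
proof (induction t)
  case 0
  then show ?case
    using x0 by (simp add: space_U_borel)
next
  case (Suc t)
  have S: "(\<lambda>(x, s). S (\<eta> t) x s) \<in> U_borel \<Otimes>\<^sub>M P \<rightarrow>\<^sub>M U_borel"
    by (rule argmin_measurable)
  have "{..<t} \<subseteq> I"
    using Suc.prems by auto
  note IH = Suc.IH[OF this]
  have z: "(\<lambda>z. z t) \<in> PiM I (\<lambda>_. P) \<rightarrow>\<^sub>M P"
    using Suc.prems by (intro measurable_component_singleton) auto
  show ?case
    using measurable_compose[OF measurable_Pair[OF IH z] S] by simp
qed

lemma sample_measurable: "t \<le> T \<Longrightarrow> \<xi> t \<in> M \<rightarrow>\<^sub>M P"
  using indep unfolding W.indep_vars_def by auto

lemma samples_measurable:
  "I \<subseteq> {..T} \<Longrightarrow> (\<lambda>\<omega>. \<lambda>i\<in>I. \<xi> i \<omega>) \<in> M \<rightarrow>\<^sub>M PiM I (\<lambda>_. P)"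
  by (intro measurable_restrict sample_measurable) auto

lemma X_eq_restrict:
  "{..<t} \<subseteq> I \<Longrightarrow> iterate S \<eta> x\<^sub>0 (\<lambda>i\<in>I. \<xi> i \<omega>) t = X t \<omega>"
  by (rule iterate_cong) auto

lemma X_measurable:
  assumes "t \<le> Suc T"
  shows "X t \<in> M \<rightarrow>\<^sub>M U_borel"
proof -
  have "{..<t} \<subseteq> {..T}"
    using assms by auto
  from measurable_compose[OF samples_measurable[OF this] iterate_measurable[OF subset_refl]]
  show ?thesis
    by (simp add: X_eq_restrict)
qed

text \<open>
  The law of \<open>X (Suc t)\<close> given \<open>X t\<close>: the iterate \<open>X t\<close> depends on the samples before time \<open>t\<close> only, which are
  independent of \<open>\<xi> t\<close>. Past and present sample are both regarded as families of samples, so that they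
  have the same type.
\<close>

lemma nn_integral_iterate_Suc:
  assumes t: "t \<le> T" and g: "g \<in> borel_measurable U_borel"
  shows "(\<integral>\<^sup>+\<omega>. g (X (Suc t) \<omega>) \<partial>M) = (\<integral>\<^sup>+\<omega>. \<integral>\<^sup>+s. g (S (\<eta> t) (X t \<omega>) s) \<partial>P \<partial>M)"
proof -
  define Past where "Past = PiM {..<t} (\<lambda>_. P)"
  define Now where "Now = PiM {t} (\<lambda>_. P)"
  define Z1 where "Z1 = (\<lambda>\<omega>. \<lambda>i\<in>{..<t}. \<xi> i \<omega>)"
  define Z2 where "Z2 = (\<lambda>\<omega>. \<lambda>i\<in>{t}. \<xi> i \<omega>)"
  have S: "(\<lambda>(x, s). S (\<eta> t) x s) \<in> U_borel \<Otimes>\<^sub>M P \<rightarrow>\<^sub>M U_borel"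
    by (rule argmin_measurable)
  define G where "G = (\<lambda>p. g (S (\<eta> t) (iterate S \<eta> x\<^sub>0 (fst p) t) (snd p t)))"
  have "(\<lambda>p. (iterate S \<eta> x\<^sub>0 (fst p) t, snd p t)) \<in> Past \<Otimes>\<^sub>M Now \<rightarrow>\<^sub>M U_borel \<Otimes>\<^sub>M P"
    unfolding Past_def Now_def
    by (intro measurable_Pair measurable_compose[OF measurable_fst iterate_measurable]
        measurable_compose[OF measurable_snd measurable_component_singleton]) auto
  from measurable_compose[OF measurable_compose[OF this S] g]
  have G: "G \<in> borel_measurable (Past \<Otimes>\<^sub>M Now)"
    by (simp add: G_def)
  have "W.indep_var Past Z1 Now Z2"
    unfolding Past_def Now_def Z1_def Z2_def using t by (intro W.indep_var_restrict[OF indep]) auto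
  then have rv: "Z1 \<in> M \<rightarrow>\<^sub>M Past" "Z2 \<in> M \<rightarrow>\<^sub>M Now"
    and joint: "distr M Past Z1 \<Otimes>\<^sub>M distr M Now Z2 = distr M (Past \<Otimes>\<^sub>M Now) (\<lambda>\<omega>. (Z1 \<omega>, Z2 \<omega>))"
    unfolding W.indep_var_distribution_eq by auto
  interpret N: prob_space "distr M Now Z2"
    by (rule W.prob_space_distr[OF rv(2)])
  have iter: "iterate S \<eta> x\<^sub>0 (Z1 \<omega>) t = X t \<omega>" for \<omega>
    unfolding Z1_def by (rule X_eq_restrict) simp
  have inner: "(\<integral>\<^sup>+z. G (Z1 \<omega>, z) \<partial>distr M Now Z2) = (\<integral>\<^sup>+s. g (S (\<eta> t) (X t \<omega>) s) \<partial>P)"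
    if \<omega>: "\<omega> \<in> space M" for \<omega>
  proof -
    have x: "X t \<omega> \<in> space U_borel"
      using measurable_space[OF X_measurable \<omega>] t by simp
    have h: "(\<lambda>s. g (S (\<eta> t) (X t \<omega>) s)) \<in> borel_measurable P"
      using measurable_compose[OF measurable_Pair1'[OF x] measurable_compose[OF S g]] by simp
    have "(\<integral>\<^sup>+z. G (Z1 \<omega>, z) \<partial>distr M Now Z2) = (\<integral>\<^sup>+\<omega>'. G (Z1 \<omega>, Z2 \<omega>') \<partial>M)"
      using measurable_compose[OF measurable_Pair1'[OF measurable_space[OF rv(1) \<omega>]] G]
      by (intro nn_integral_distr[OF rv(2)]) simp
    also have "\<dots> = (\<integral>\<^sup>+\<omega>'. g (S (\<eta> t) (X t \<omega>) (\<xi> t \<omega>')) \<partial>M)"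
      by (simp add: G_def iter) (simp add: Z2_def)
    also have "\<dots> = (\<integral>\<^sup>+s. g (S (\<eta> t) (X t \<omega>) s) \<partial>distr M P (\<xi> t))"
      using nn_integral_distr[OF sample_measurable[OF t], of "\<lambda>s. g (S (\<eta> t) (X t \<omega>) s)"] h by simp
    finally show ?thesis
      by (simp add: distr[OF t])
  qed
  have "(\<integral>\<^sup>+\<omega>. g (X (Suc t) \<omega>) \<partial>M) = (\<integral>\<^sup>+\<omega>. G (Z1 \<omega>, Z2 \<omega>) \<partial>M)"
    by (simp add: G_def iter) (simp add: Z2_def)
  also have "\<dots> = integral\<^sup>N (distr M Past Z1 \<Otimes>\<^sub>M distr M Now Z2) G"
    unfolding joint using rv G by (subst nn_integral_distr) auto
  also have "\<dots> = (\<integral>\<^sup>+x. \<integral>\<^sup>+z. G (x, z) \<partial>distr M Now Z2 \<partial>distr M Past Z1)"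
    using G by (subst N.nn_integral_fst) (auto cong: measurable_cong_sets)
  also have "\<dots> = (\<integral>\<^sup>+\<omega>. \<integral>\<^sup>+z. G (Z1 \<omega>, z) \<partial>distr M Now Z2 \<partial>M)"
  proof (rule nn_integral_distr[OF rv(1)])
    have "G \<in> borel_measurable (Past \<Otimes>\<^sub>M distr M Now Z2)"
      using G by (simp cong: measurable_cong_sets)
    from N.borel_measurable_nn_integral_fst[OF this]
    show "(\<lambda>x. \<integral>\<^sup>+z. G (x, z) \<partial>distr M Now Z2) \<in> borel_measurable (distr M Past Z1)"
      by simp
  qed
  also have "\<dots> = (\<integral>\<^sup>+\<omega>. \<integral>\<^sup>+s. g (S (\<eta> t) (X t \<omega>) s) \<partial>P \<partial>M)"
    by (intro nn_integral_cong inner)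
  finally show ?thesis .
qed

lemma expected_recursion:
  assumes t: "t \<le> T"
  shows "(\<integral>\<^sup>+\<omega>. env_gap (X (Suc t) \<omega>) \<partial>M)
      + ennreal (step_weight (\<eta> t) / lam) * (\<integral>\<^sup>+\<omega>. reg_gap (X (Suc t) \<omega>) \<partial>M)
      + ennreal (descent_rate * step_weight (\<eta> t)) * (\<integral>\<^sup>+\<omega>. prox_gap (X t \<omega>) \<partial>M)
    \<le> (\<integral>\<^sup>+\<omega>. env_gap (X t \<omega>) \<partial>M)
      + ennreal (step_weight (\<eta> t) / lam) * (\<integral>\<^sup>+\<omega>. reg_gap (X t \<omega>) \<partial>M)
      + ennreal (C\<^sup>2 * ((\<eta> t)\<^sup>2 / (4 * lam * (1 - \<eta> t * \<rho>))))"
proof -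
  define k where "k = ennreal (step_weight (\<eta> t) / lam)"
  define d where "d = ennreal (descent_rate * step_weight (\<eta> t))"
  define c where "c = ennreal (C\<^sup>2 * ((\<eta> t)\<^sup>2 / (4 * lam * (1 - \<eta> t * \<rho>))))"
  note [measurable] = env_gap_measurable reg_gap_measurable prox_gap_measurable
  have X[measurable]: "X t \<in> M \<rightarrow>\<^sub>M U_borel" "X (Suc t) \<in> M \<rightarrow>\<^sub>M U_borel"
    using X_measurable[of t] X_measurable[of "Suc t"] t by (auto simp del: iterate.simps)
  have XU: "X t \<omega> \<in> intdom \<Phi>" if "\<omega> \<in> space M" for \<omega>
    using measurable_space[OF X(1) that] by (simp add: space_U_borel)
  have Sm[measurable]: "(\<lambda>(x, s). S (\<eta> t) x s) \<in> U_borel \<Otimes>\<^sub>M P \<rightarrow>\<^sub>M U_borel"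
    by (rule argmin_measurable)
  define g where "g = (\<lambda>x. env_gap x + k * reg_gap x)"
  have g[measurable]: "g \<in> borel_measurable U_borel"
    unfolding g_def by measurable
  have inner: "(\<lambda>x. \<integral>\<^sup>+s. g (S (\<eta> t) x s) \<partial>P) \<in> borel_measurable U_borel"
    using borel_measurable_nn_integral_fst[OF measurable_compose[OF Sm g]] by simp
  have [measurable]: "(\<lambda>\<omega>. \<integral>\<^sup>+s. g (S (\<eta> t) (X t \<omega>) s) \<partial>P) \<in> borel_measurable M"
    by (rule measurable_compose[OF X(1) inner])
  have m1: "(\<lambda>\<omega>. env_gap (X u \<omega>)) \<in> borel_measurable M" "(\<lambda>\<omega>. reg_gap (X u \<omega>)) \<in> borel_measurable M"
    "(\<lambda>\<omega>. prox_gap (X u \<omega>)) \<in> borel_measurable M" if "X u \<in> M \<rightarrow>\<^sub>M U_borel" for u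
    using measurable_compose[OF that env_gap_measurable] measurable_compose[OF that reg_gap_measurable]
      measurable_compose[OF that prox_gap_measurable] by auto
  have int_g: "(\<integral>\<^sup>+\<omega>. g (X u \<omega>) \<partial>M) = (\<integral>\<^sup>+\<omega>. env_gap (X u \<omega>) \<partial>M) + k * (\<integral>\<^sup>+\<omega>. reg_gap (X u \<omega>) \<partial>M)"
    if "X u \<in> M \<rightarrow>\<^sub>M U_borel" for u
    using m1[OF that] by (simp add: g_def nn_integral_add nn_integral_cmult)
  have "(\<integral>\<^sup>+\<omega>. g (X (Suc t) \<omega>) \<partial>M) + d * (\<integral>\<^sup>+\<omega>. prox_gap (X t \<omega>) \<partial>M)
      = (\<integral>\<^sup>+\<omega>. (\<integral>\<^sup>+s. g (S (\<eta> t) (X t \<omega>) s) \<partial>P) + d * prox_gap (X t \<omega>) \<partial>M)"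
    using m1[OF X(1)] nn_integral_iterate_Suc[OF t g] by (simp add: nn_integral_add nn_integral_cmult)
  also have "\<dots> \<le> (\<integral>\<^sup>+\<omega>. g (X t \<omega>) + c \<partial>M)"
    unfolding g_def k_def d_def c_def
    by (intro nn_integral_mono expected_step XU \<eta>_pos \<eta>_less)
  also have "\<dots> = (\<integral>\<^sup>+\<omega>. g (X t \<omega>) \<partial>M) + c"
    using measurable_compose[OF X(1) g] by (simp add: nn_integral_add W.emeasure_space_1)
  finally show ?thesis
    unfolding int_g[OF X(1)] int_g[OF X(2)] k_def d_def c_def .
qed

text \<open>
  The weights \<open>step_weight (\<eta> t) / lam\<close> of \<open>reg_gap\<close> inherit monotonicity from the step sizes. This is the
  place where these have to be nonincreasing.
\<close>

lemma weighted_sum_bound: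
  "(\<Sum>t\<le>T. ennreal (descent_rate * step_weight (\<eta> t)) * (\<integral>\<^sup>+\<omega>. prox_gap (X t \<omega>) \<partial>M))
    \<le> env_gap x\<^sub>0 + ennreal (step_weight (\<eta> 0) / lam) * reg_gap x\<^sub>0
      + (\<Sum>t\<le>T. ennreal (C\<^sup>2 * ((\<eta> t)\<^sup>2 / (4 * lam * (1 - \<eta> t * \<rho>)))))"
  (is "?s \<le> ?u")
proof -
  have mono: "ennreal (step_weight (\<eta> (Suc t)) / lam) \<le> ennreal (step_weight (\<eta> t) / lam)" for t
    using step_weight_mono[OF \<eta>_pos decseq_SucD[OF \<eta>_dec] \<eta>_less, of t] lam_pos
    by (intro ennreal_leI divide_right_mono) auto
  have "?s \<le> (\<integral>\<^sup>+\<omega>. env_gap (X (Suc T) \<omega>) \<partial>M)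
      + ennreal (step_weight (\<eta> T) / lam) * (\<integral>\<^sup>+\<omega>. reg_gap (X (Suc T) \<omega>) \<partial>M) + ?s"
    by (simp add: add_increasing)
  also have "\<dots> \<le> (\<integral>\<^sup>+\<omega>. env_gap (X 0 \<omega>) \<partial>M)
      + ennreal (step_weight (\<eta> 0) / lam) * (\<integral>\<^sup>+\<omega>. reg_gap (X 0 \<omega>) \<partial>M)
      + (\<Sum>t\<le>T. ennreal (C\<^sup>2 * ((\<eta> t)\<^sup>2 / (4 * lam * (1 - \<eta> t * \<rho>)))))"
    using mono expected_recursion
    by (intro weighted_telescoping[where T = T and k = "\<lambda>t. ennreal (step_weight (\<eta> t) / lam)"
          and A = "\<lambda>t. \<integral>\<^sup>+\<omega>. env_gap (X t \<omega>) \<partial>M" and R = "\<lambda>t. \<integral>\<^sup>+\<omega>. reg_gap (X t \<omega>) \<partial>M"]) blast+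
  also have "\<dots> = ?u"
    by (simp add: W.emeasure_space_1)
  finally show ?thesis .
qed

text \<open>
  Conditioning on the value of \<open>tstar\<close>: for fixed \<open>t\<close> the iterate \<open>X t\<close> is a function of the samples and hence
  independent of the event \<open>tstar = t\<close>.
\<close>

lemma nn_integral_random_index:
  fixes p :: "nat \<Rightarrow> real"
  assumes tstar: "tstar \<in> M \<rightarrow>\<^sub>M count_space UNIV"
    and indep_tstar: "W.indep_set
      (sets (vimage_algebra (space M) tstar (count_space UNIV)))
      (sets (vimage_algebra (space M) (\<lambda>\<omega>. \<lambda>t\<in>{..T}. \<xi> t \<omega>) (PiM {..T} (\<lambda>_. P))))"
    and p: "\<And>t. measure M {\<omega> \<in> space M. tstar \<omega> = t} = p t" and p0: "\<And>t. T < t \<Longrightarrow> p t = 0"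
    and g: "g \<in> borel_measurable U_borel"
  shows "(\<integral>\<^sup>+\<omega>. g (X (tstar \<omega>) \<omega>) \<partial>M) = (\<Sum>t\<le>T. ennreal (p t) * (\<integral>\<^sup>+\<omega>. g (X t \<omega>) \<partial>M))"
proof -
  have eq: "{\<omega> \<in> space M. tstar \<omega> = t} = tstar -` {t} \<inter> space M" for t
    by auto
  have sets: "{\<omega> \<in> space M. tstar \<omega> = t} \<in> sets M" for t
    unfolding eq by (rule measurable_sets[OF tstar]) simp
  have em: "emeasure M {\<omega> \<in> space M. tstar \<omega> = t} = ennreal (p t)" for t
    by (simp add: W.emeasure_eq_measure p)
  have "AE \<omega> in M. tstar \<omega> \<noteq> t" if "T < t" for t
    using em[of t] p0[OF that] sets[of t] by (intro AE_I[of _ _ "{\<omega> \<in> space M. tstar \<omega> = t}"]) auto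
  then have "AE \<omega> in M. \<forall>t\<in>{T<..}. tstar \<omega> \<noteq> t"
    by (subst AE_ball_countable) auto
  then have "(\<integral>\<^sup>+\<omega>. g (X (tstar \<omega>) \<omega>) \<partial>M)
      = (\<integral>\<^sup>+\<omega>. (\<Sum>t\<le>T. indicator {t} (tstar \<omega>) * g (X t \<omega>)) \<partial>M)"
  proof (intro nn_integral_cong_AE, eventually_elim)
    case (elim \<omega>)
    then have "tstar \<omega> \<le> T"
      by (metis greaterThan_iff not_le)
    then have "(\<Sum>t\<le>T. indicator {t} (tstar \<omega>) * g (X t \<omega>))
        = (\<Sum>t\<le>T. if t = tstar \<omega> then g (X t \<omega>) else 0)"
      by (intro sum.cong) (auto simp: indicator_def)
    then show ?case
      using \<open>tstar \<omega> \<le> T\<close> by (simp add: sum.delta)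
  qed
  also have "\<dots> = (\<Sum>t\<le>T. \<integral>\<^sup>+\<omega>. indicator {t} (tstar \<omega>) * g (X t \<omega>) \<partial>M)"
  proof (rule nn_integral_sum)
    fix t assume "t \<in> {..T}"
    then have "(\<lambda>\<omega>. g (X t \<omega>)) \<in> borel_measurable M"
      using measurable_compose[OF X_measurable g] by simp
    moreover have "(\<lambda>\<omega>. indicator {t} (tstar \<omega>) :: ennreal) \<in> borel_measurable M"
      by (rule measurable_compose[OF tstar]) simp
    ultimately show "(\<lambda>\<omega>. indicator {t} (tstar \<omega>) * g (X t \<omega>)) \<in> borel_measurable M"
      by simp
  qed
  also have "\<dots> = (\<Sum>t\<le>T. ennreal (p t) * (\<integral>\<^sup>+\<omega>. g (X t \<omega>) \<partial>M))"
  proof (rule sum.cong)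
    fix t assume "t \<in> {..T}"
    then have "(\<lambda>z. g (iterate S \<eta> x\<^sub>0 z t)) \<in> borel_measurable (PiM {..T} (\<lambda>_. P))"
      by (intro measurable_compose[OF iterate_measurable g]) auto
    from W.nn_integral_mult_indep[OF tstar samples_measurable[OF subset_refl] indep_tstar _ this, of "indicator {t}"]
    have "(\<integral>\<^sup>+\<omega>. indicator {t} (tstar \<omega>) * g (iterate S \<eta> x\<^sub>0 (\<lambda>t\<in>{..T}. \<xi> t \<omega>) t) \<partial>M)
        = (\<integral>\<^sup>+\<omega>. indicator {t} (tstar \<omega>) \<partial>M) * (\<integral>\<^sup>+\<omega>. g (iterate S \<eta> x\<^sub>0 (\<lambda>t\<in>{..T}. \<xi> t \<omega>) t) \<partial>M)"
      by simp
    moreover have "iterate S \<eta> x\<^sub>0 (\<lambda>t\<in>{..T}. \<xi> t \<omega>) t = X t \<omega>" for \<omega>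
      using \<open>t \<in> {..T}\<close> by (intro X_eq_restrict) auto
    moreover have "(\<integral>\<^sup>+\<omega>. indicator {t} (tstar \<omega>) \<partial>M) = ennreal (p t)"
    proof -
      have "(\<integral>\<^sup>+\<omega>. indicator {t} (tstar \<omega>) \<partial>M) = (\<integral>\<^sup>+\<omega>. indicator {\<omega> \<in> space M. tstar \<omega> = t} \<omega> \<partial>M)"
        by (intro nn_integral_cong) (auto simp: indicator_def)
      then show ?thesis
        using sets[of t] by (simp add: em)
    qed
    ultimately show "(\<integral>\<^sup>+\<omega>. indicator {t} (tstar \<omega>) * g (X t \<omega>) \<partial>M)
        = ennreal (p t) * (\<integral>\<^sup>+\<omega>. g (X t \<omega>) \<partial>M)"
      by simp
  qed simp
  finally show ?thesis .
qed

end

section \<open>Convergence of stochastic model-based minimization\<close>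

theorem theorem5p2:
  fixes \<Phi> r :: "'a::euclidean_space \<Rightarrow> ereal"
    and f :: "'a \<Rightarrow> real"
    and P :: "'s measure"
    and m :: "'a \<Rightarrow> 'a \<Rightarrow> 's \<Rightarrow> real"
    and S :: "real \<Rightarrow> 'a \<Rightarrow> 's \<Rightarrow> 'a"
    and \<tau> \<rho> C lam :: real
    and \<eta> :: "nat \<Rightarrow> real"
    and T :: nat
    and x\<^sub>0 :: 'a
    and M :: "'w measure"
    and \<xi> :: "nat \<Rightarrow> 'w \<Rightarrow> 's"
    and tstar :: "'w \<Rightarrow> nat"
  assumes "legendre \<Phi>"
    and "composite_problem \<Phi> f r"
    and "prob_space P"
    and "\<tau> > 0" and "\<rho> > 0" and "C > 0"
    and "one_sided_accurate P \<Phi> f r m \<tau>"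
    and "weakly_convex_models P \<Phi> r m \<rho>"
    and "lipschitz_models P \<Phi> r m C"
    and "prox_solvable \<Phi> (objective f r) (inverse (\<tau> + \<rho>))"
    and "model_argmin_map P \<Phi> r m (inverse (\<tau> + \<rho>)) S"
    and "x\<^sub>0 \<in> intdom \<Phi> \<inter> effdom r"
    and "0 < lam" and "lam < inverse (\<tau> + \<rho>)"
    and "decseq \<eta>" and "\<And>t. 0 < \<eta> t \<and> \<eta> t < lam"
    and "algorithm_randomness M P \<rho> \<eta> T \<xi> tstar"
    and "\<exists>x. \<forall>y. objective f r x \<le> objective f r y"
  shows "enn2ereal (\<integral>\<^sup>+ \<omega>. e2ennreal
           (let x = iterate S \<eta> x\<^sub>0 (\<lambda>t. \<xi> t \<omega>) (tstar \<omega>)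
            in bregman \<Phi> (prox \<Phi> (objective f r) lam x) x) \<partial>M)
         \<le> ereal (lam\<^sup>2 / (1 - lam * (\<tau> + \<rho>))) *
             ((envelope \<Phi> (objective f r) lam x\<^sub>0 - (INF x. objective f r x))
                / ereal (\<Sum>t\<le>T. \<eta> t / (1 - \<eta> t * \<rho>))
              + ereal (C\<^sup>2 * (\<Sum>t\<le>T. (\<eta> t)\<^sup>2 / (4 * lam * (1 - \<eta> t * \<rho>))))
                / ereal (\<Sum>t\<le>T. \<eta> t / (1 - \<eta> t * \<rho>))
              + ereal (\<eta> 0 / (lam * (1 - \<eta> 0 * \<rho>))) * (r x\<^sub>0 - (INF x. r x))
                / ereal (\<Sum>t\<le>T. \<eta> t / (1 - \<eta> t * \<rho>)))"
proof -
  let ?F = "objective f r"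
  define w where "w = (\<lambda>t. \<eta> t / (1 - \<eta> t * \<rho>))"
  define W where "W = (\<Sum>t\<le>T. w t)"
  have r_proper: "r x \<noteq> -\<infinity>" for x
    using assms(2) unfolding composite_problem_def by simp
  have x0: "x\<^sub>0 \<in> intdom \<Phi>" "r x\<^sub>0 < \<infinity>"
    using assms(12) by (auto simp: effdom_def)
  obtain a where a: "r x\<^sub>0 = ereal a"
    using x0(2) r_proper[of x\<^sub>0] by (cases "r x\<^sub>0") auto
  obtain xmin where xmin: "\<And>y. ?F xmin \<le> ?F y"
    using assms(18) by blast
  have INF_F: "(INF x. ?F x) = ?F xmin"
    by (intro antisym INF_lower INF_greatest xmin) simp
  obtain Fl where Fl: "?F xmin = ereal Fl"
    using xmin[of x\<^sub>0] r_proper[of xmin] by (cases "r xmin") (auto simp: objective_def a)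
  have F_lower: "ereal Fl \<le> ?F y" for y
    using xmin[of y] by (simp add: Fl)
  have env0: "ereal Fl \<le> envelope \<Phi> ?F lam x\<^sub>0"
    by (rule envelope_ge[OF assms(1) x0(1) assms(13) F_lower])
  have \<eta>: "0 < \<eta> t" "\<eta> t < lam" for t
    using assms(16) by auto
  have lam: "lam * (\<tau> + \<rho>) < 1"
    using assms(4,5,14) by (simp add: inverse_eq_divide less_divide_eq)
  have \<eta>\<rho>: "\<eta> t * \<rho> < 1" for t
  proof -
    have "\<eta> t * \<rho> \<le> lam * (\<tau> + \<rho>)"
      using \<eta>[of t] assms(4,5) by (intro mult_mono) auto
    then show ?thesis
      using lam by simp
  qed
  have w_pos: "0 < w t" for t
    using \<eta>(1)[of t] \<eta>\<rho>[of t] by (simp add: w_def)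
  have W_pos: "0 < W"
    unfolding W_def using w_pos by (intro sum_pos) auto
  show ?thesis
  proof (cases "INF x. r x")
    (* If r is unbounded below, the last summand of the bound is \<infinity> and the first is not -\<infinity>. *)
    case MInf
    have "0 \<le> (envelope \<Phi> ?F lam x\<^sub>0 - (INF x. ?F x)) / ereal W"
      using env0 W_pos unfolding INF_F Fl
      by (cases "envelope \<Phi> ?F lam x\<^sub>0") auto
    moreover have "0 \<le> C\<^sup>2 * (\<Sum>t\<le>T. (\<eta> t)\<^sup>2 / (4 * lam * (1 - \<eta> t * \<rho>)))"
      using \<eta>\<rho> assms(13) by (intro mult_nonneg_nonneg sum_nonneg divide_nonneg_nonneg) (auto simp: less_imp_le)
    moreover have "0 < \<eta> 0 / (lam * (1 - \<eta> 0 * \<rho>))"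
      using \<eta>[of 0] \<eta>\<rho>[of 0] assms(13) by simp
    moreover have "0 < lam\<^sup>2 / (1 - lam * (\<tau> + \<rho>))"
      using lam assms(13) by simp
    ultimately have "ereal (lam\<^sup>2 / (1 - lam * (\<tau> + \<rho>))) *
             ((envelope \<Phi> ?F lam x\<^sub>0 - (INF x. ?F x)) / ereal W
              + ereal (C\<^sup>2 * (\<Sum>t\<le>T. (\<eta> t)\<^sup>2 / (4 * lam * (1 - \<eta> t * \<rho>)))) / ereal W
              + ereal (\<eta> 0 / (lam * (1 - \<eta> 0 * \<rho>))) * (r x\<^sub>0 - (INF x. r x)) / ereal W) = \<infinity>"
      using W_pos unfolding MInf a
      by (cases "(envelope \<Phi> ?F lam x\<^sub>0 - (INF x. ?F x)) / ereal W") auto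
    then show ?thesis
      unfolding W_def w_def by (simp only: ereal_less_eq(1))
  next
    case PInf
    then show ?thesis
      using INF_lower[of x\<^sub>0 UNIV r] by (simp add: a)
  next
    case (real rl)
    have r_lower: "ereal rl \<le> r x" for x
      using INF_lower[of x UNIV r] by (simp add: real)
    have alg: "prob_space M" "prob_space.indep_vars M (\<lambda>_. P) \<xi> {..T}"
        "\<And>t. t \<le> T \<Longrightarrow> distr M P (\<xi> t) = P" "tstar \<in> M \<rightarrow>\<^sub>M count_space UNIV"
        "\<And>t. measure M {\<omega> \<in> space M. tstar \<omega> = t} = (if t \<le> T then w t / W else 0)"
        "prob_space.indep_set M
           (sets (vimage_algebra (space M) tstar (count_space UNIV)))
           (sets (vimage_algebra (space M) (\<lambda>\<omega>. \<lambda>t\<in>{..T}. \<xi> t \<omega>) (PiM {..T} (\<lambda>_. P))))"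
      using assms(17) unfolding algorithm_randomness_def W_def w_def by auto
    interpret stochastic_model_run P \<Phi> r f m S \<tau> \<rho> C lam rl Fl M \<eta> T x\<^sub>0 \<xi>
      unfolding stochastic_model_run_def stochastic_model_run_axioms_def
        stochastic_model_problem_def stochastic_model_problem_axioms_def
      using assms alg r_lower F_lower x0 by auto
    have step_weight: "step_weight (\<eta> t) = w t" for t
      by (simp add: step_weight_def w_def)
    define e where "e = (\<lambda>t. C\<^sup>2 * ((\<eta> t)\<^sup>2 / (4 * lam * (1 - \<eta> t * \<rho>))))"
    have e0: "0 \<le> e t" for t
      using \<eta>\<rho>[of t] assms(13) by (simp add: e_def)
    obtain v where v: "Env x\<^sub>0 = ereal v" "Fl \<le> v"
      using env0 envelope_le_objective[OF x0(1)] by (cases "Env x\<^sub>0") (auto simp: objective_def a)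
    have ra: "rl \<le> a"
      using r_lower[of x\<^sub>0] by (simp add: a)
    define b where "b = v - Fl + w 0 / lam * (a - rl) + (\<Sum>t\<le>T. e t)"
    have w0: "0 \<le> w 0 / lam"
      using w_pos[of 0] assms(13) by simp
    have b0: "0 \<le> b"
      unfolding b_def using v ra w0 e0 by (intro add_nonneg_nonneg mult_nonneg_nonneg sum_nonneg) auto
    have bound: "(\<Sum>t\<le>T. ennreal (descent_rate * w t) * (\<integral>\<^sup>+\<omega>. prox_gap (X t \<omega>) \<partial>M)) \<le> ennreal b"
    proof -
      have "env_gap x\<^sub>0 + ennreal (w 0 / lam) * reg_gap x\<^sub>0 + (\<Sum>t\<le>T. ennreal (e t))
          = ennreal (v - Fl) + ennreal (w 0 / lam) * ennreal (a - rl) + ennreal (\<Sum>t\<le>T. e t)"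
        by (simp add: env_gap_def reg_gap_def v a e0)
      also have "\<dots> = ennreal b"
        unfolding b_def using v ra w0 e0
        by (subst ennreal_mult[symmetric] | subst ennreal_plus[symmetric]
            | intro add_nonneg_nonneg mult_nonneg_nonneg sum_nonneg | simp)+
      finally show ?thesis
        using weighted_sum_bound unfolding step_weight e_def by simp
    qed
    have dW: "0 \<le> 1 / (descent_rate * W)"
      using descent_rate_pos W_pos by simp
    have "(\<integral>\<^sup>+ \<omega>. prox_gap (X (tstar \<omega>) \<omega>) \<partial>M)
        = (\<Sum>t\<le>T. ennreal (w t / W) * (\<integral>\<^sup>+\<omega>. prox_gap (X t \<omega>) \<partial>M))"
      by (subst nn_integral_random_index[OF alg(4,6,5) _ prox_gap_measurable]) auto
    also have "\<dots> = ennreal (1 / (descent_rate * W)) *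
        (\<Sum>t\<le>T. ennreal (descent_rate * w t) * (\<integral>\<^sup>+\<omega>. prox_gap (X t \<omega>) \<partial>M))"
    proof -
      have "ennreal (w t / W) = ennreal (1 / (descent_rate * W)) * ennreal (descent_rate * w t)" for t
        using descent_rate_pos w_pos[of t] W_pos dW by (simp add: ennreal_mult[symmetric])
      then show ?thesis
        by (simp add: sum_distrib_left mult.assoc)
    qed
    also have "\<dots> \<le> ennreal (1 / (descent_rate * W)) * ennreal b"
      by (intro mult_left_mono bound) simp
    also have "\<dots> = ennreal (1 / (descent_rate * W) * b)"
      using dW b0 by (simp only: ennreal_mult)
    finally have "enn2ereal (\<integral>\<^sup>+ \<omega>. prox_gap (X (tstar \<omega>) \<omega>) \<partial>M) \<le> enn2ereal (ennreal (1 / (descent_rate * W) * b))"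
      by (simp only: less_eq_ennreal.rep_eq)
    also have "\<dots> = ereal (1 / (descent_rate * W) * b)"
      by (rule enn2ereal_ennreal[OF mult_nonneg_nonneg[OF dW b0]])
    also have "1 / (descent_rate * W) * b = lam\<^sup>2 / (1 - lam * (\<tau> + \<rho>)) *
        ((v - Fl) / W + C\<^sup>2 * (\<Sum>t\<le>T. (\<eta> t)\<^sup>2 / (4 * lam * (1 - \<eta> t * \<rho>))) / W
          + \<eta> 0 / (lam * (1 - \<eta> 0 * \<rho>)) * (a - rl) / W)"
    proof -
      have "(\<Sum>t\<le>T. e t) = C\<^sup>2 * (\<Sum>t\<le>T. (\<eta> t)\<^sup>2 / (4 * lam * (1 - \<eta> t * \<rho>)))"
        by (simp add: e_def sum_distrib_left)
      moreover have "w 0 / lam = \<eta> 0 / (lam * (1 - \<eta> 0 * \<rho>))"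
        by (simp add: w_def mult.commute)
      ultimately have "b / W = (v - Fl) / W + C\<^sup>2 * (\<Sum>t\<le>T. (\<eta> t)\<^sup>2 / (4 * lam * (1 - \<eta> t * \<rho>))) / W
          + \<eta> 0 / (lam * (1 - \<eta> 0 * \<rho>)) * (a - rl) / W"
        by (simp add: b_def add_divide_distrib)
      moreover have "1 / (descent_rate * W) * b = lam\<^sup>2 / (1 - lam * (\<tau> + \<rho>)) * (b / W)"
        by (simp add: descent_rate_def)
      ultimately show ?thesis
        by (simp only:)
    qed
    finally have "enn2ereal (\<integral>\<^sup>+ \<omega>. prox_gap (X (tstar \<omega>) \<omega>) \<partial>M) \<le> \<dots>" .
    then show ?thesis
      using W_pos unfolding INF_F Fl real a v prox_gap_def Let_def W_def[unfolded w_def, symmetric]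
      by simp
  qed
qed

end
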